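(* Let $\Omega\subset\mathbb{R}^3$ be a bounded domain, placed in the smallest box $I=(0,l_1)\times(0,l_2)\times(0,l_3)$ as described in the context. Let $\phi=(\phi_1,\phi_2,\phi_3)\in\mathring{\mathsf R}(\Omega)$. Then for every permutation $(i,j,k)$ of $\{1,2,3\}$, all $0\le\alpha_j<\beta_j\le l_j$ and all $0\le\alpha_k<\beta_k\le l_k$, with $\Omega_k=\{x\in\Omega \mid \alpha_k<x_k<\beta_k\}$ and $\Omega_{jk}=\{x\in\Omega \mid \alpha_j<x_j<\beta_j,\ \alpha_k<x_k<\beta_k\}$, $$\left|\int_{\Omega_{jk}}\phi_i\,\mathrm{d}x\right|\le(\beta_j-\alpha_j)\,|(\operatorname{rot}\phi)_k|_{\mathsf L^1(\Omega_k)} .$$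
   Context: $\Omega$ is a bounded domain (open connected set) in $\mathbb{R}^3$; no boundary regularity is assumed. $\Omega$ is translated so that it is contained in the rectangular cuboid $I=(0,l_1)\times(0,l_2)\times(0,l_3)$, $0<l_1,l_2,l_3<\infty$, with $I$ as small as possible. $|\cdot|_{\mathsf L^1(\omega)}$ is the norm of $\mathsf L^1(\omega)$. For a vector field $\phi$ the rotation is $\operatorname{rot}\phi=(\partial_2\phi_3-\partial_3\phi_2,\ \partial_3\phi_1-\partial_1\phi_3,\ \partial_1\phi_2-\partial_2\phi_1)$, and $(\operatorname{rot}\phi)_k$ is its $k$-th component. $\mathsf R(\Omega)$ is the space of vector fields $\phi\in\mathsf L^2(\Omega)$ (with values in $\mathbb{R}^3$) whose weak rotation $\operatorname{rot}\phi$ belongs to $\mathsf L^2(\Omega)$. $\mathring{\mathsf R}(\Omega)$ is the closure in $\mathsf R(\Omega)$ of the smooth vector fields with compact support in $\Omega$, with respect to the graph norm $(|\phi|_{\mathsf L^2}^2+|\operatorname{rot}\phi|_{\mathsf L^2}^2)^{1/2}$. *)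

theory Defs
  imports "HOL-Analysis.Analysis"
begin

text \<open>\<open>C\<^sup>k\<close> on the whole space, by iterated Frechet derivatives in fixed directions.\<close>

primrec continuously_differentiable ::
    "nat \<Rightarrow> ('a::real_normed_vector \<Rightarrow> 'b::real_normed_vector) \<Rightarrow> bool" where
  "continuously_differentiable 0 f \<longleftrightarrow> continuous_on UNIV f"
| "continuously_differentiable (Suc n) f \<longleftrightarrow>
     (\<forall>x. f differentiable (at x)) \<and>
     (\<forall>v. continuously_differentiable n (\<lambda>x. frechet_derivative f (at x) v))"

text \<open>Test fields are taken on all of \<open>\<real>\<^sup>3\<close>: a smooth field with compact support in
  \<open>\<Omega>\<close> is identified with its extension by zero.\<close>

definition test_fields :: "(real^3) set \<Rightarrow> (real^3 \<Rightarrow> real^3) set" where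
  "test_fields \<Omega> = {\<theta>. (\<forall>n. continuously_differentiable n \<theta>) \<and>
     compact (closure {x. \<theta> x \<noteq> 0}) \<and> closure {x. \<theta> x \<noteq> 0} \<subseteq> \<Omega>}"

definition partial_deriv :: "3 \<Rightarrow> (real^3 \<Rightarrow> real) \<Rightarrow> real^3 \<Rightarrow> real" where
  "partial_deriv j f x = frechet_derivative f (at x) (axis j 1)"

definition classical_rot :: "(real^3 \<Rightarrow> real^3) \<Rightarrow> real^3 \<Rightarrow> real^3" where
  "classical_rot \<theta> x = vector
     [partial_deriv 2 (\<lambda>y. \<theta> y $ 3) x - partial_deriv 3 (\<lambda>y. \<theta> y $ 2) x,
      partial_deriv 3 (\<lambda>y. \<theta> y $ 1) x - partial_deriv 1 (\<lambda>y. \<theta> y $ 3) x,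
      partial_deriv 1 (\<lambda>y. \<theta> y $ 2) x - partial_deriv 2 (\<lambda>y. \<theta> y $ 1) x]"

text \<open>Elements of the Lebesgue spaces are represented by functions; values outside \<open>\<Omega>\<close>
  are irrelevant, and functions that agree almost everywhere are not identified.\<close>

definition L2_fields :: "(real^3) set \<Rightarrow> (real^3 \<Rightarrow> real^3) set" where
  "L2_fields \<Omega> = {\<phi>. \<phi> \<in> borel_measurable (lebesgue_on \<Omega>) \<and>
     integrable (lebesgue_on \<Omega>) (\<lambda>x. (norm (\<phi> x))\<^sup>2)}"

definition L2_norm :: "(real^3) set \<Rightarrow> (real^3 \<Rightarrow> real^3) \<Rightarrow> real" where
  "L2_norm \<Omega> \<phi> = sqrt (\<integral>x. (norm (\<phi> x))\<^sup>2 \<partial>lebesgue_on \<Omega>)"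

definition L1_norm :: "(real^3) set \<Rightarrow> (real^3 \<Rightarrow> real) \<Rightarrow> real" where
  "L1_norm \<omega> f = (\<integral>x. \<bar>f x\<bar> \<partial>lebesgue_on \<omega>)"

text \<open>No sign appears because the rotation is formally self-adjoint.\<close>

definition has_weak_rot ::
    "(real^3) set \<Rightarrow> (real^3 \<Rightarrow> real^3) \<Rightarrow> (real^3 \<Rightarrow> real^3) \<Rightarrow> bool" where
  "has_weak_rot \<Omega> \<phi> \<psi> \<longleftrightarrow> \<psi> \<in> L2_fields \<Omega> \<and>
     (\<forall>\<theta>\<in>test_fields \<Omega>. (\<integral>x. \<phi> x \<bullet> classical_rot \<theta> x \<partial>lebesgue_on \<Omega>) =
                          (\<integral>x. \<psi> x \<bullet> \<theta> x \<partial>lebesgue_on \<Omega>))"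

definition R_space :: "(real^3) set \<Rightarrow> (real^3 \<Rightarrow> real^3) set" where
  "R_space \<Omega> = {\<phi> \<in> L2_fields \<Omega>. \<exists>\<psi>. has_weak_rot \<Omega> \<phi> \<psi>}"

text \<open>A representative of the weak rotation; unspecified unless \<open>\<phi>\<close> has one. For open
  \<open>\<Omega>\<close> it is determined up to a null subset of \<open>\<Omega>\<close>.\<close>

definition weak_rot :: "(real^3) set \<Rightarrow> (real^3 \<Rightarrow> real^3) \<Rightarrow> real^3 \<Rightarrow> real^3" where
  "weak_rot \<Omega> \<phi> = (SOME \<psi>. has_weak_rot \<Omega> \<phi> \<psi>)"

definition graph_norm :: "(real^3) set \<Rightarrow> (real^3 \<Rightarrow> real^3) \<Rightarrow> real" where
  "graph_norm \<Omega> \<phi> = sqrt ((L2_norm \<Omega> \<phi>)\<^sup>2 + (L2_norm \<Omega> (weak_rot \<Omega> \<phi>))\<^sup>2)"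

definition R0_space :: "(real^3) set \<Rightarrow> (real^3 \<Rightarrow> real^3) set" where
  "R0_space \<Omega> = {\<phi> \<in> R_space \<Omega>.
     \<forall>\<epsilon>>0. \<exists>\<theta>\<in>test_fields \<Omega>. graph_norm \<Omega> (\<lambda>x. \<phi> x - \<theta> x) < \<epsilon>}"

definition smallest_box :: "(real^3) set \<Rightarrow> real^3 \<Rightarrow> bool" where
  "smallest_box \<Omega> l \<longleftrightarrow> (\<forall>m. 0 < l $ m) \<and> \<Omega> \<subseteq> box 0 l \<and>
     (\<forall>a b. \<Omega> \<subseteq> box a b \<longrightarrow> box 0 l \<subseteq> box a b)"

end

theory Submission
  imports Defs
begin

text \<open>
  For a test field \<open>\<theta>\<close> the estimate is one integration by parts. Let \<open>1\<^sub>k\<close> be the indicator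
  of the slab \<open>\<alpha>\<^sub>k < x\<^sub>k < \<beta>\<^sub>k\<close>, let \<open>W\<close> be the ramp \<open>s \<mapsto> min \<beta>\<^sub>j (max \<alpha>\<^sub>j s) - \<alpha>\<^sub>j\<close>, which rises from
  \<open>0\<close> to \<open>\<beta>\<^sub>j - \<alpha>\<^sub>j\<close>, and put \<open>g(x) = 1\<^sub>k(x) W(x\<^sub>j)\<close>. This weight is Lipschitz in direction \<open>j\<close>, with
  derivative the indicator of the box, and does not depend on \<open>x\<^sub>i\<close>. Hence the integral of \<open>\<theta>\<^sub>i\<close> over
  the box is \<open>- \<integral> g \<partial>\<^sub>j\<theta>\<^sub>i\<close>, while \<open>\<integral> g \<partial>\<^sub>i\<theta>\<^sub>j = 0\<close>. Subtracting, it equals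
  \<open>- \<integral> g (\<partial>\<^sub>j\<theta>\<^sub>i - \<partial>\<^sub>i\<theta>\<^sub>j)\<close>, where the bracket is \<open>\<plusminus> (rot \<theta>)\<^sub>k\<close> and
  \<open>0 \<le> g \<le> (\<beta>\<^sub>j - \<alpha>\<^sub>j) 1\<^sub>k\<close> (lemma \<open>test_field_box_integral_le\<close>). The weight \<open>g\<close> is not smooth,
  so the integration by parts is carried out on difference quotients, using the translation
  invariance of Lebesgue measure and dominated convergence
  (lemma \<open>integral_mult_directional_derivative\<close>); no iterated integrals are needed.

  For general \<open>\<phi>\<close>, take test fields \<open>\<theta>\<close> close to \<open>\<phi>\<close> in the graph norm. On a bounded set convergence in
  \<open>L\<^sup>2\<close> gives convergence in \<open>L\<^sup>1\<close>, so both sides pass to the limit, provided that the chosen weak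
  rotation of \<open>\<phi> - \<theta>\<close> is almost everywhere the chosen weak rotation of \<open>\<phi>\<close> minus the classical one of
  \<open>\<theta>\<close>. This needs two facts: a test field has its classical rotation as weak rotation
  (lemma \<open>has_weak_rot_classical_rot\<close>), and weak rotations are unique up to null sets
  (lemma \<open>weak_rot_unique\<close>). The latter is the fundamental lemma of the calculus of variations:
  indicators of boxes are bounded pointwise limits of smooth bump functions, and a function whose
  integrals over all boxes vanish is zero almost everywhere.
\<close>

section \<open>Closure properties of continuous differentiability\<close>

lemma continuously_differentiable_continuous:
  "continuously_differentiable n f \<Longrightarrow> continuous_on UNIV f"
  by (cases n) (auto intro!: continuous_at_imp_continuous_on differentiable_imp_continuous_within)

lemma continuously_differentiable_Suc_imp:
  "continuously_differentiable (Suc n) f \<Longrightarrow> continuously_differentiable n f"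
proof (induction n arbitrary: f)
  case 0
  show ?case using continuously_differentiable_continuous[OF 0] by simp
next
  case (Suc n)
  then show ?case by (metis continuously_differentiable.simps(2))
qed

lemma continuously_differentiable_SucI:
  assumes "\<And>x. (f has_derivative f' x) (at x)"
    and "\<And>v. continuously_differentiable n (\<lambda>x. f' x v)"
  shows "continuously_differentiable (Suc n) f"
proof -
  have "frechet_derivative f (at x) = f' x" for x
    using frechet_derivative_at[OF assms(1)] by simp
  with assms show ?thesis by (auto simp: differentiable_def)
qed

lemma continuously_differentiable_SucD:
  assumes "continuously_differentiable (Suc n) f"
  shows "(f has_derivative frechet_derivative f (at x)) (at x)"
    and "continuously_differentiable n (\<lambda>x. frechet_derivative f (at x) v)"
  using assms by (auto simp: frechet_derivative_works)

lemma continuously_differentiable_const: "continuously_differentiable n (\<lambda>x. c)"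
proof (induction n arbitrary: c)
  case (Suc n)
  show ?case by (rule continuously_differentiable_SucI[where f' = "\<lambda>x v. 0"]) (auto intro: Suc)
qed simp

lemma continuously_differentiable_add:
  assumes "continuously_differentiable n f" "continuously_differentiable n g"
  shows "continuously_differentiable n (\<lambda>x. f x + g x)"
  using assms
proof (induction n arbitrary: f g)
  case 0
  then show ?case by (simp add: continuous_on_add)
next
  case (Suc n)
  note f = continuously_differentiable_SucD[OF Suc.prems(1)]
  note g = continuously_differentiable_SucD[OF Suc.prems(2)]
  show ?case
    by (rule continuously_differentiable_SucI[OF has_derivative_add[OF f(1) g(1)] Suc.IH[OF f(2) g(2)]])
qed

lemma continuously_differentiable_mult:
  fixes f g :: "'a::real_normed_vector \<Rightarrow> real"
  assumes "continuously_differentiable n f" "continuously_differentiable n g"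
  shows "continuously_differentiable n (\<lambda>x. f x * g x)"
  using assms
proof (induction n arbitrary: f g)
  case 0
  then show ?case by (simp add: continuous_on_mult)
next
  case (Suc n)
  note f = continuously_differentiable_SucD[OF Suc.prems(1)]
  note g = continuously_differentiable_SucD[OF Suc.prems(2)]
  show ?case
    by (rule continuously_differentiable_SucI[OF has_derivative_mult[OF f(1) g(1)]])
       (intro continuously_differentiable_add Suc.IH f(2) g(2)
          Suc.prems[THEN continuously_differentiable_Suc_imp])
qed

lemma continuously_differentiable_prod:
  fixes f :: "'b \<Rightarrow> 'a::real_normed_vector \<Rightarrow> real"
  assumes "\<And>i. i \<in> I \<Longrightarrow> continuously_differentiable n (f i)"
  shows "continuously_differentiable n (\<lambda>x. \<Prod>i\<in>I. f i x)"
  using assms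
  by (induction I rule: infinite_finite_induct)
     (auto intro: continuously_differentiable_const continuously_differentiable_mult)

lemma continuously_differentiable_bounded_linear:
  assumes "bounded_linear h" "continuously_differentiable n f"
  shows "continuously_differentiable n (\<lambda>x. h (f x))"
  using assms(2)
proof (induction n arbitrary: f)
  case 0
  then show ?case using assms(1) by (simp add: bounded_linear.continuous_on)
next
  case (Suc n)
  note f = continuously_differentiable_SucD[OF Suc.prems]
  show ?case
    by (rule continuously_differentiable_SucI[OF bounded_linear.has_derivative[OF assms(1) f(1)]
          Suc.IH[OF f(2)]])
qed

section \<open>Smooth bump functions on boxes\<close>

text \<open>The function \<open>t \<mapsto> exp (-1/t) / t^k\<close> extended by zero to \<open>t \<le> 0\<close>. The family is closed under
  differentiation up to linear combinations, which makes every member smooth.\<close>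

definition flat :: "nat \<Rightarrow> real \<Rightarrow> real" where
  "flat k t = (if t > 0 then exp (- (1 / t)) / t ^ k else 0)"

lemma flat_tendsto_0: "(flat k \<longlongrightarrow> 0) (at 0)"
proof -
  \<comment> \<open>With \<open>s = 1/t\<close> this is the decay of \<open>s^k / exp s\<close> at infinity.\<close>
  have "((\<lambda>t::real. inverse t ^ k / exp (inverse t)) \<longlongrightarrow> 0) (at_right 0)"
    by (rule filterlim_compose[OF tendsto_power_div_exp_0 filterlim_inverse_at_top_right])
  moreover have "eventually (\<lambda>t. inverse t ^ k / exp (inverse t) = flat k t) (at_right (0::real))"
    using eventually_at_right_less[of "0::real"]
    by eventually_elim (auto simp: flat_def exp_minus field_simps)
  ultimately have "(flat k \<longlongrightarrow> 0) (at_right 0)" by (rule Lim_transform_eventually)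
  moreover have "(flat k \<longlongrightarrow> 0) (at_left 0)"
    by (rule Lim_transform_eventually[OF tendsto_const])
       (auto simp: flat_def eventually_at_filter)
  ultimately show ?thesis by (simp add: filterlim_split_at)
qed

lemma flat_has_derivative:
  "(flat k has_real_derivative (flat (k + 2) t - real k * flat (k + 1) t)) (at t)"
proof -
  consider "t > 0" | "t < 0" | "t = 0" by linarith
  then show ?thesis
  proof cases
    case 1
    have "((\<lambda>t. exp (- (1 / t)) / t ^ k) has_real_derivative
        (flat (k + 2) t - real k * flat (k + 1) t)) (at t)"
    proof -
      have "((\<lambda>t. exp (- (1 / t)) / t ^ k) has_real_derivative
          (exp (- (1 / t)) * (1 / (t * t)) * t ^ k - exp (- (1 / t)) * (real k * t ^ (k - 1)))
            / (t ^ k * t ^ k)) (at t)"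
        using 1 by (intro DERIV_divide) (auto intro!: derivative_eq_intros)
      moreover have "(exp (- (1 / t)) * (1 / (t * t)) * t ^ k - exp (- (1 / t)) * (real k * t ^ (k - 1)))
            / (t ^ k * t ^ k) = flat (k + 2) t - real k * flat (k + 1) t"
        using 1 by (cases k) (simp_all add: flat_def field_simps)
      ultimately show ?thesis by simp
    qed
    then show ?thesis
      by (rule has_field_derivative_transform_within_open[where S = "{0<..}"])
         (use 1 in \<open>auto simp: flat_def\<close>)
  next
    case 2
    have "((\<lambda>t. 0) has_real_derivative (flat (k + 2) t - real k * flat (k + 1) t)) (at t)"
      using 2 by (auto simp: flat_def)
    then show ?thesis
      by (rule has_field_derivative_transform_within_open[where S = "{..<0}"])
         (use 2 in \<open>auto simp: flat_def\<close>)
  next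
    case 3
    \<comment> \<open>The difference quotient at \<open>0\<close> is itself a member of the family.\<close>
    have "(\<lambda>h. (flat k (0 + h) - flat k 0) / h) = flat (k + 1)"
      by (auto simp: flat_def fun_eq_iff)
    with flat_tendsto_0[of "k + 1"] show ?thesis
      unfolding 3 DERIV_def by (simp add: flat_def)
  qed
qed

text \<open>The induction on the order of differentiability runs over all \<open>k\<close> at once, since the derivative
  of a member of the family involves two other members.\<close>

lemma continuously_differentiable_flat:
  assumes h: "bounded_linear h"
  shows "continuously_differentiable n (\<lambda>x. flat k (h x + d))"
proof (induction n arbitrary: k)
  case 0
  have "continuous_on UNIV (flat k)"
    by (intro continuous_at_imp_continuous_on ballI DERIV_isCont[OF flat_has_derivative])
  moreover have "continuous_on UNIV (\<lambda>x. h x + d)"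
    by (intro continuous_on_add bounded_linear.continuous_on[OF h] continuous_on_id continuous_on_const)
  ultimately show ?case using continuous_on_compose2[of UNIV "flat k"] by fastforce
next
  case (Suc n)
  have "((\<lambda>x. flat k (h x + d)) has_derivative
      (\<lambda>v. (flat (k + 2) (h x + d) + (- real k) * flat (k + 1) (h x + d)) * h v)) (at x)" for x
  proof -
    have "((\<lambda>x. h x + d) has_derivative h) (at x)"
      by (intro has_derivative_add_const bounded_linear_imp_has_derivative h)
    from has_derivative_compose[OF this, OF flat_has_derivative[THEN has_field_derivative_imp_has_derivative]]
    show ?thesis by simp
  qed
  then show ?case
    by (rule continuously_differentiable_SucI)
       (intro continuously_differentiable_add continuously_differentiable_mult
          continuously_differentiable_const Suc)
qed

text \<open>A smooth function that is positive exactly on the open box \<open>box a b\<close>. The factor \<open>Suc n\<close> inside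
  \<open>flat 0\<close> amounts to taking the \<open>Suc n\<close>-th root of the bump with factor \<open>1\<close>; as \<open>n\<close> grows, the
  functions increase to the indicator of the box.\<close>

definition box_bump :: "real^'n \<Rightarrow> real^'n \<Rightarrow> nat \<Rightarrow> real^'n \<Rightarrow> real" where
  "box_bump a b n x = (\<Prod>m\<in>UNIV. flat 0 (real (Suc n) * (x $ m - a $ m)) *
                                  flat 0 (real (Suc n) * (b $ m - x $ m)))"

lemma continuously_differentiable_box_bump: "continuously_differentiable p (box_bump a b n)"
proof -
  have bl: "bounded_linear (\<lambda>x::real^'n. c * x $ m)" for c m
    by (intro bounded_linear_const_mult bounded_linear_vec_nth)
  have "continuously_differentiable p (\<lambda>x::real^'n. flat 0 (c * x $ m + d))" for c d m
    using continuously_differentiable_flat[OF bl] .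
  note * = this[of "real (Suc n)" _ "- real (Suc n) * a $ _"] this[of "- real (Suc n)" _ "real (Suc n) * b $ _"]
  have "continuously_differentiable p (\<lambda>x. \<Prod>m\<in>UNIV. flat 0 (real (Suc n) * x $ m + - real (Suc n) * a $ m) *
      flat 0 (- real (Suc n) * x $ m + real (Suc n) * b $ m))"
    by (intro continuously_differentiable_prod continuously_differentiable_mult *)
  moreover have "box_bump a b n = (\<lambda>x. \<Prod>m\<in>UNIV.
      flat 0 (real (Suc n) * x $ m + - real (Suc n) * a $ m) *
      flat 0 (- real (Suc n) * x $ m + real (Suc n) * b $ m))"
    by (simp add: box_bump_def fun_eq_iff algebra_simps)
  ultimately show ?thesis by simp
qed

lemma box_bump_nonzero_iff: "box_bump a b n x \<noteq> 0 \<longleftrightarrow> x \<in> box a b"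
proof -
  have "flat 0 t \<noteq> 0 \<longleftrightarrow> 0 < t" for t by (simp add: flat_def)
  then show ?thesis
    by (simp add: box_bump_def mem_box_cart zero_less_mult_iff del: of_nat_Suc)
qed

lemma box_bump_bounds: "0 \<le> box_bump a b n x" "box_bump a b n x \<le> 1"
proof -
  have *: "0 \<le> flat 0 t \<and> flat 0 t \<le> 1" for t by (simp add: flat_def)
  show "0 \<le> box_bump a b n x" unfolding box_bump_def by (intro prod_nonneg) (simp add: *)
  show "box_bump a b n x \<le> 1" unfolding box_bump_def 
    by (intro prod_le_1) (simp add: * mult_le_one)
qed

lemma box_bump_tendsto_indicator: "(\<lambda>n. box_bump a b n x) \<longlonglongrightarrow> indicator (box a b) x"
proof (cases "x \<in> box a b")
  case True
  have *: "(\<lambda>n. flat 0 (real (Suc n) * t)) \<longlonglongrightarrow> 1" if "t > 0" for t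
  proof -
    have "(\<lambda>n. exp (- (inverse (real (Suc n)) * inverse t))) \<longlonglongrightarrow> exp (- (0 * inverse t))"
      by (intro tendsto_intros LIMSEQ_inverse_real_of_nat)
    moreover have "flat 0 (real (Suc n) * t) = exp (- (inverse (real (Suc n)) * inverse t))" for n
      using that by (simp add: flat_def divide_inverse del: of_nat_Suc)
    ultimately show ?thesis by simp
  qed
  have "(\<lambda>n. box_bump a b n x) \<longlonglongrightarrow> (\<Prod>m\<in>(UNIV::'a set). 1 * 1)"
    unfolding box_bump_def
    by (intro tendsto_prod tendsto_mult *) (use True in \<open>auto simp: mem_box_cart\<close>)
  then show ?thesis using True by simp
next
  case False
  then have "box_bump a b n x = 0" for n
    using box_bump_nonzero_iff by blast
  with False show ?thesis by simp
qed

section \<open>Integration by parts against a Lipschitz weight\<close>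

text \<open>The function \<open>u\<close> is continuously differentiable in direction \<open>e\<close> with derivative \<open>u'\<close> and vanishes
  outside a ball. The weight \<open>g\<close> is bounded, Lipschitz in direction \<open>e\<close>, and has the left derivative
  \<open>g'\<close> almost everywhere in that direction; it may be discontinuous in the others.\<close>

lemma integral_mult_directional_derivative:
  fixes u u' g g' :: "'a::euclidean_space \<Rightarrow> real"
  assumes deriv: "\<And>x. ((\<lambda>t. u (x + t *\<^sub>R e)) has_real_derivative u' x) (at 0)"
    and u: "continuous_on UNIV u" and u': "continuous_on UNIV u'"
    and supp: "\<And>x. norm x > r \<Longrightarrow> u x = 0"
    and g[measurable]: "g \<in> borel_measurable borel" and g_bound: "\<And>x. \<bar>g x\<bar> \<le> K"
    and g_lip: "\<And>x h. h > 0 \<Longrightarrow> \<bar>g x - g (x - h *\<^sub>R e)\<bar> \<le> L * h"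
    and g'[measurable]: "g' \<in> borel_measurable borel"
    and g_deriv: "AE x in lborel. ((\<lambda>h. (g x - g (x - h *\<^sub>R e)) / h) \<longlongrightarrow> g' x) (at_right 0)"
  shows "(\<integral>x. g x * u' x \<partial>lborel) = - (\<integral>x. g' x * u x \<partial>lborel)"
proof -
  have [measurable]: "u \<in> borel_measurable borel" "u' \<in> borel_measurable borel"
    using u u' by (auto intro: borel_measurable_continuous_onI)
  define h :: "nat \<Rightarrow> real" where "h n = inverse (real (Suc n))" for n
  have h: "0 < h n" "h n \<le> 1" for n
    by (auto simp: h_def field_simps)
  have h_right: "filterlim h (at_right 0) sequentially"
    unfolding filterlim_at using LIMSEQ_inverse_real_of_nat h
    by (auto simp: h_def[abs_def] intro!: always_eventually)
  have bdd: "\<exists>M. \<forall>x\<in>cball 0 R. \<bar>f x\<bar> \<le> M" if "continuous_on UNIV f" for f :: "'a \<Rightarrow> real" and R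
  proof -
    have "compact (f ` cball 0 R)"
      by (intro compact_continuous_image compact_cball continuous_on_subset[OF that]) auto
    from compact_imp_bounded[OF this] show ?thesis
      unfolding bounded_iff by (auto simp: real_norm_def)
  qed
  obtain M where M: "\<bar>u' x\<bar> \<le> M" if "norm x \<le> r + 2 * norm e" for x
    using bdd[OF u', of "r + 2 * norm e"] unfolding Ball_def mem_cball_0 by blast
  obtain N where N: "\<bar>u x\<bar> \<le> N" if "norm x \<le> r" for x
    using bdd[OF u, of r] unfolding Ball_def mem_cball_0 by blast
  let ?B = "cball (0::'a) (r + norm e)"
  have fin: "emeasure lborel (cball (0::'a) R) < \<infinity>" for R
    by (intro emeasure_bounded_finite) simp
  have int_u: "integrable lborel u"
  proof (rule Bochner_Integration.integrable_bound)
    show "integrable lborel (\<lambda>x. N * indicator (cball (0::'a) r) x)"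
      using fin by (intro integrable_mult_right integrable_real_indicator) auto
    show "AE x in lborel. norm (u x) \<le> norm (N * indicator (cball 0 r) x)"
      using supp N by (auto intro!: AE_I2 simp: indicator_def not_le intro: order_trans[OF _ abs_ge_self])
  qed simp
  have int_gu: "integrable lborel (\<lambda>x. q x * u x)"
    if [measurable]: "q \<in> borel_measurable borel" and q: "\<And>x. \<bar>q x\<bar> \<le> K" for q
  proof (rule Bochner_Integration.integrable_bound)
    show "integrable lborel (\<lambda>x. K * u x)" by (intro integrable_mult_right int_u)
    show "AE x in lborel. norm (q x * u x) \<le> norm (K * u x)"
      using q by (auto simp: abs_mult intro!: mult_right_mono order_trans[OF q abs_ge_self])
  qed simp
  \<comment> \<open>Translation invariance moves the increment from \<open>u\<close> to \<open>g\<close>.\<close>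
  have shift: "integrable lborel (\<lambda>x. g x * u (x + h n *\<^sub>R e))"
    "(\<integral>x. g x * u (x + h n *\<^sub>R e) \<partial>lborel) = (\<integral>x. g (x - h n *\<^sub>R e) * u x \<partial>lborel)" for n
  proof -
    have i: "integrable lborel (\<lambda>x. g (x - h n *\<^sub>R e) * u x)"
      by (rule int_gu) (auto simp: g_bound)
    have d: "distr lborel borel (\<lambda>x. h n *\<^sub>R e + x) = (lborel :: 'a measure)"
      by (rule lborel_distr_plus)
    from i show "integrable lborel (\<lambda>x. g x * u (x + h n *\<^sub>R e))"
      by (subst (asm) d[symmetric]) (simp add: integrable_distr_eq add.commute)
    show "(\<integral>x. g x * u (x + h n *\<^sub>R e) \<partial>lborel) = (\<integral>x. g (x - h n *\<^sub>R e) * u x \<partial>lborel)"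
      by (subst (2) d[symmetric]) (simp add: integral_distr add.commute)
  qed
  have lim1: "(\<lambda>n. \<integral>x. g x * ((u (x + h n *\<^sub>R e) - u x) / h n) \<partial>lborel) \<longlonglongrightarrow> (\<integral>x. g x * u' x \<partial>lborel)"
  proof (rule integral_dominated_convergence[where w = "\<lambda>x. (K * M) * indicator ?B x"])
    show "integrable lborel (\<lambda>x. K * M * indicator ?B x)"
      using fin by (intro integrable_mult_right integrable_real_indicator) auto
    show "AE x in lborel. (\<lambda>n. g x * ((u (x + h n *\<^sub>R e) - u x) / h n)) \<longlonglongrightarrow> g x * u' x"
    proof (intro AE_I2 tendsto_mult tendsto_const)
      fix x
      have "((\<lambda>t. (u (x + t *\<^sub>R e) - u x) / t) \<longlongrightarrow> u' x) (at_right 0)"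
        using deriv[of x] unfolding DERIV_def
        by (auto intro: tendsto_mono at_le)
      from filterlim_compose[OF this h_right]
      show "(\<lambda>n. (u (x + h n *\<^sub>R e) - u x) / h n) \<longlonglongrightarrow> u' x" .
    qed
    show "AE x in lborel. norm (g x * ((u (x + h n *\<^sub>R e) - u x) / h n)) \<le> K * M * indicator ?B x" for n
    proof (rule AE_I2)
      fix x :: 'a
      have hx: "norm (h n *\<^sub>R e) \<le> norm e" using h[of n] by (simp add: mult_left_le_one_le)
      show "norm (g x * ((u (x + h n *\<^sub>R e) - u x) / h n)) \<le> K * M * indicator ?B x"
      proof (cases "x \<in> ?B")
        case True
        \<comment> \<open>The difference quotient of \<open>u\<close> is a value of \<open>u'\<close> at an intermediate point.\<close>
        have "((\<lambda>t. u (x + t *\<^sub>R e)) has_real_derivative u' (x + s *\<^sub>R e)) (at s)" for s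
        proof -
          have "((\<lambda>t. u ((x + s *\<^sub>R e) + t *\<^sub>R e)) has_real_derivative u' (x + s *\<^sub>R e)) (at 0)"
            by (rule deriv)
          then show ?thesis
            using DERIV_shift[of "\<lambda>t. u (x + t *\<^sub>R e)" "u' (x + s *\<^sub>R e)" 0 s]
            by (simp add: algebra_simps)
        qed
        then obtain s where s: "0 < s" "s < h n"
          "u (x + h n *\<^sub>R e) - u (x + 0 *\<^sub>R e) = (h n - 0) * u' (x + s *\<^sub>R e)"
          using MVT2[OF h(1)[of n], of "\<lambda>t. u (x + t *\<^sub>R e)" "\<lambda>s. u' (x + s *\<^sub>R e)"] by blast
        have "norm (s *\<^sub>R e) \<le> norm e" using s h[of n] by (simp add: mult_left_le_one_le)
        then have "\<bar>u' (x + s *\<^sub>R e)\<bar> \<le> M"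
          using True by (intro M) (auto intro: order_trans[OF norm_triangle_ineq])
        then have "\<bar>g x\<bar> * \<bar>u' (x + s *\<^sub>R e)\<bar> \<le> K * M"
          using g_bound[of x] by (intro mult_mono) auto
        then show ?thesis using s True h[of n] by (simp add: abs_mult)
      next
        case False
        then have "norm x > r + norm e" by auto
        moreover from this have "norm (x + h n *\<^sub>R e) > r"
          using hx norm_triangle_ineq4[of "x + h n *\<^sub>R e" "h n *\<^sub>R e"] by simp
        moreover have "norm x > r" using \<open>norm x > r + norm e\<close> norm_ge_zero[of e] by linarith
        ultimately show ?thesis using supp False by simp
      qed
    qed
  qed simp_all
  have lim2: "(\<lambda>n. \<integral>x. - ((g x - g (x - h n *\<^sub>R e)) / h n) * u x \<partial>lborel) \<longlonglongrightarrow> (\<integral>x. - g' x * u x \<partial>lborel)"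
  proof (rule integral_dominated_convergence[where w = "\<lambda>x. L * \<bar>u x\<bar>"])
    show "integrable lborel (\<lambda>x. L * \<bar>u x\<bar>)" using int_u by simp
    show "AE x in lborel. (\<lambda>n. - ((g x - g (x - h n *\<^sub>R e)) / h n) * u x) \<longlonglongrightarrow> - g' x * u x"
      using g_deriv
    proof eventually_elim
      case (elim x)
      from filterlim_compose[OF elim h_right] show ?case by (intro tendsto_intros) simp
    qed
    show "AE x in lborel. norm (- ((g x - g (x - h n *\<^sub>R e)) / h n) * u x) \<le> L * \<bar>u x\<bar>" for n
    proof (rule AE_I2)
      fix x :: 'a
      have "\<bar>(g x - g (x - h n *\<^sub>R e)) / h n\<bar> \<le> L"
        using g_lip[OF h(1)[of n], of x] h(1)[of n] by (simp add: pos_divide_le_eq)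
      then show "norm (- ((g x - g (x - h n *\<^sub>R e)) / h n) * u x) \<le> L * \<bar>u x\<bar>"
        by (simp only: real_norm_def abs_mult abs_minus_cancel mult_right_mono abs_ge_zero)
    qed
  qed simp_all
  have "(\<integral>x. g x * ((u (x + h n *\<^sub>R e) - u x) / h n) \<partial>lborel) =
      (\<integral>x. - ((g x - g (x - h n *\<^sub>R e)) / h n) * u x \<partial>lborel)" for n
  proof -
    have a: "integrable lborel (\<lambda>x. g x * u x)" "integrable lborel (\<lambda>x. g (x - h n *\<^sub>R e) * u x)"
      by (rule int_gu; auto simp: g_bound)+
    have "(\<integral>x. g x * ((u (x + h n *\<^sub>R e) - u x) / h n) \<partial>lborel)
      = (\<integral>x. (g x * u (x + h n *\<^sub>R e) - g x * u x) / h n \<partial>lborel)"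
      by (simp add: algebra_simps)
    also have "\<dots> = ((\<integral>x. g x * u (x + h n *\<^sub>R e) \<partial>lborel) - (\<integral>x. g x * u x \<partial>lborel)) / h n"
      using a shift by simp
    also have "\<dots> = (\<integral>x. (g (x - h n *\<^sub>R e) * u x - g x * u x) / h n \<partial>lborel)"
      using a shift by simp
    also have "\<dots> = (\<integral>x. - ((g x - g (x - h n *\<^sub>R e)) / h n) * u x \<partial>lborel)"
      by (intro Bochner_Integration.integral_cong)
         (auto simp: algebra_simps diff_divide_distrib)
    finally show ?thesis .
  qed
  with lim1 lim2 have "(\<integral>x. g x * u' x \<partial>lborel) = (\<integral>x. - g' x * u x \<partial>lborel)"
    using LIMSEQ_unique by auto
  then show ?thesis by simp
qed

section \<open>Functions with vanishing integrals over boxes\<close>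

text \<open>Boxes form an intersection-stable generator of the Borel sets. The support condition makes the
  integral over the whole space an integral over a box, which gives closure under complements.\<close>

lemma AE_zero_if_box_integrals_zero_supported:
  fixes f :: "'a::euclidean_space \<Rightarrow> real"
  assumes f: "integrable lebesgue f"
    and box: "\<And>a b. (LINT x:box a b|lebesgue. f x) = 0"
    and supp: "\<And>x. x \<notin> box c d \<Longrightarrow> f x = 0"
  shows "AE x in lebesgue. f x = 0"
proof -
  have [measurable]: "f \<in> borel_measurable lebesgue" using f by auto
  have si: "set_integrable lebesgue A f" if "A \<in> sets lebesgue" for A
    unfolding set_integrable_def by (rule integrable_mult_indicator[OF that f])
  have total: "(\<integral>x. f x \<partial>lebesgue) = 0"
  proof -
    have "(\<integral>x. f x \<partial>lebesgue) = (LINT x:box c d|lebesgue. f x)"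
      unfolding set_lebesgue_integral_def
      by (intro Bochner_Integration.integral_cong) (auto simp: indicator_def supp)
    then show ?thesis using box by simp
  qed
  have Int_stable: "Int_stable (range (\<lambda>(a, b). box a b :: 'a set))"
    by (auto simp: Int_stable_def box_Int_box)
  have borel: "(LINT x:A|lebesgue. f x) = 0" if "A \<in> sets borel" for A
  proof -
    note Int_stable
    moreover have "range (\<lambda>(a, b). box a b :: 'a set) \<subseteq> Pow UNIV" by simp
    moreover have "A \<in> sigma_sets UNIV (range (\<lambda>(a, b). box a b :: 'a set))"
      using that unfolding borel_eq_box by simp
    ultimately show ?thesis
    proof (induction rule: sigma_sets_induct_disjoint)
      case (compl A)
      then have "A \<in> sets borel" unfolding borel_eq_box by simp
      then have A: "A \<in> sets lebesgue" "UNIV - A \<in> sets lebesgue" by auto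
      have "(LINT x:A \<union> (UNIV - A)|lebesgue. f x) =
          (LINT x:A|lebesgue. f x) + (LINT x:UNIV - A|lebesgue. f x)"
        using A by (intro set_integral_Un si) auto
      moreover have "(LINT x:A \<union> (UNIV - A)|lebesgue. f x) = 0"
        using total by (simp add: set_lebesgue_integral_def)
      ultimately show ?case using compl by simp
    next
      case (union A)
      then have "A i \<in> sets borel" for i unfolding borel_eq_box by auto
      then have A: "A i \<in> sets lebesgue" for i by auto
      have "(LINT x:(\<Union>i. A i)|lebesgue. f x) = (\<Sum>i. (LINT x:A i|lebesgue. f x))"
        using A union(1) by (intro lebesgue_integral_countable_add si) (auto simp: disjoint_family_on_def)
      then show ?case using union by simp
    qed (auto simp: set_lebesgue_integral_def box[unfolded set_lebesgue_integral_def, simplified])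
  qed
  have "AE x in lebesgue. f x = (\<lambda>x. 0) x"
  proof (rule density_unique_real[OF f integrable_zero])
    fix A :: "'a set" assume "A \<in> sets lebesgue"
    then obtain S N N' where A: "A = S \<union> N" "N \<subseteq> N'" "N' \<in> null_sets lborel" "S \<in> sets lborel"
      by (auto elim: sets_completionE)
    have "(LINT x:A|lebesgue. f x) = (LINT x:S|lebesgue. f x)"
    proof (rule set_integral_cong_set)
      show "set_borel_measurable lebesgue A f" "set_borel_measurable lebesgue S f"
        using A \<open>A \<in> sets lebesgue\<close> si[of A] si[of S]
        by (auto simp: set_borel_measurable_def set_integrable_def)
      have "AE x in lebesgue. x \<notin> N'" using A by (intro AE_not_in) (auto intro: null_sets_completionI)
      then show "AE x in lebesgue. (x \<in> S) = (x \<in> A)"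
        by eventually_elim (use A in auto)
    qed
    with borel[of S] A show "(LINT x:A|lebesgue. f x) = (LINT x:A|lebesgue. 0)"
      by (simp add: set_lebesgue_integral_def)
  qed
  then show ?thesis by simp
qed

text \<open>Only boxes whose closed box lies in \<open>\<Omega>\<close> are needed: restrict to each of countably many closed boxes
  that cover \<open>\<Omega>\<close>.\<close>

lemma AE_zero_if_box_integrals_zero:
  fixes f :: "'a::euclidean_space \<Rightarrow> real"
  assumes "open \<Omega>" and f: "integrable (lebesgue_on \<Omega>) f"
    and box: "\<And>a b. cbox a b \<subseteq> \<Omega> \<Longrightarrow> (\<integral>x. indicator (box a b) x * f x \<partial>lebesgue_on \<Omega>) = 0"
  shows "AE x in lebesgue_on \<Omega>. f x = 0"
proof -
  have \<Omega>: "\<Omega> \<in> sets lebesgue" using \<open>open \<Omega>\<close> by auto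
  have f': "integrable lebesgue (\<lambda>x. indicator \<Omega> x *\<^sub>R f x)"
    using f \<Omega> by (simp add: integrable_restrict_space)
  have *: "AE x in lebesgue. x \<in> cbox c d \<longrightarrow> f x = 0" if cd: "cbox c d \<subseteq> \<Omega>" for c d
  proof -
    let ?f = "\<lambda>x. indicator (box c d) x * f x"
    have f_eq: "?f = (\<lambda>x. indicator (box c d) x *\<^sub>R (indicator \<Omega> x *\<^sub>R f x))"
      using cd box_subset_cbox[of c d] by (auto simp: fun_eq_iff indicator_def)
    have "AE x in lebesgue. ?f x = 0"
    proof (rule AE_zero_if_box_integrals_zero_supported[where c = c and d = d])
      show "integrable lebesgue ?f"
        unfolding f_eq by (intro integrable_mult_indicator f') auto
      show "(LINT x:box a b|lebesgue. ?f x) = 0" for a b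
      proof -
        obtain p q where pq: "box a b \<inter> box c d = box p q"
          using box_Int_box[of a b c d] by blast
        show ?thesis
        proof (cases "box p q = {}")
          case True
          then have "(\<lambda>x. indicator (box a b) x *\<^sub>R ?f x) = (\<lambda>x. 0)"
            using pq by (auto simp: indicator_def fun_eq_iff)
          then show ?thesis by (simp only: set_lebesgue_integral_def integral_zero)
        next
          case False
          moreover have "closure (box p q) \<subseteq> cbox c d"
            using pq box_subset_cbox[of c d] by (intro closure_minimal) auto
          ultimately have "cbox p q \<subseteq> \<Omega>" using cd by simp
          have "(LINT x:box a b|lebesgue. ?f x) = (\<integral>x. indicator \<Omega> x *\<^sub>R (indicator (box p q) x * f x) \<partial>lebesgue)"
            unfolding set_lebesgue_integral_def pq[symmetric] using cd box_subset_cbox[of c d]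
            by (intro Bochner_Integration.integral_cong) (auto simp: indicator_def)
          also have "\<dots> = (\<integral>x. indicator (box p q) x * f x \<partial>lebesgue_on \<Omega>)"
            using \<Omega> by (simp add: integral_restrict_space)
          finally show ?thesis using box[OF \<open>cbox p q \<subseteq> \<Omega>\<close>] by simp
        qed
      qed
    qed auto
    moreover have "AE x in lebesgue. x \<notin> cbox c d - box c d"
    proof -
      have "negligible (cbox c d - box c d)" by (rule negligible_frontier_interval)
      then show ?thesis by (intro AE_not_in) (simp add: negligible_iff_null_sets)
    qed
    ultimately show ?thesis by eventually_elim (auto simp: indicator_def split: if_splits)
  qed
  obtain D where D: "countable D" "D \<subseteq> Pow \<Omega>" "\<And>X. X \<in> D \<Longrightarrow> \<exists>a b. X = cbox a b" "\<Union>D = \<Omega>"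
    using open_countable_Union_open_cbox[OF \<open>open \<Omega>\<close>] by blast
  have "AE x in lebesgue. x \<in> X \<longrightarrow> f x = 0" if X: "X \<in> D" for X
  proof -
    obtain c d where "X = cbox c d" using D(3)[OF X] by blast
    with * X D(2) show ?thesis by blast
  qed
  then have "AE x in lebesgue. \<forall>X\<in>D. x \<in> X \<longrightarrow> f x = 0"
    by (subst AE_ball_countable[OF D(1)]) simp
  then have "AE x in lebesgue. x \<in> \<Omega> \<longrightarrow> f x = 0"
    by eventually_elim (use D(4) in auto)
  then show ?thesis using \<Omega> by (simp add: AE_restrict_space_iff)
qed

section \<open>Square integrable fields on sets of finite measure\<close>

lemma L2_fields_integrable:
  assumes "\<phi> \<in> L2_fields \<Omega>" "\<Omega> \<in> lmeasurable"
  shows "integrable (lebesgue_on \<Omega>) \<phi>"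
proof -
  have const: "integrable (lebesgue_on \<Omega>) (\<lambda>x. 1 :: real)"
    by (rule finite_measure.integrable_const[OF finite_measure_lebesgue_on[OF assms(2)]])
  show ?thesis
  proof (rule Bochner_Integration.integrable_bound)
    show "integrable (lebesgue_on \<Omega>) (\<lambda>x. 1 + (norm (\<phi> x))\<^sup>2)"
      using assms const by (simp add: L2_fields_def)
    have "t \<le> 1 + t\<^sup>2" for t :: real
    proof -
      have "2 * t \<le> t\<^sup>2 + 1" using zero_le_power2[of "t - 1"] by (simp add: power2_diff)
      with zero_le_power2[of t] show ?thesis by linarith
    qed
    then show "AE x in lebesgue_on \<Omega>. norm (\<phi> x) \<le> norm (1 + (norm (\<phi> x))\<^sup>2)"
      by (intro AE_I2) (simp add: abs_of_nonneg)
  qed (use assms in \<open>simp add: L2_fields_def\<close>)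
qed

lemma L2_fields_component_integrable:
  assumes "\<phi> \<in> L2_fields \<Omega>" "\<Omega> \<in> lmeasurable"
  shows "integrable (lebesgue_on \<Omega>) (\<lambda>x. \<phi> x $ m)"
  using integrable_bounded_linear[OF bounded_linear_vec_nth L2_fields_integrable[OF assms]] .

lemma integral_norm_le_of_L2_norm_le:
  assumes \<phi>: "\<phi> \<in> L2_fields \<Omega>" and \<Omega>: "\<Omega> \<in> lmeasurable" and "\<epsilon> > 0" "L2_norm \<Omega> \<phi> \<le> \<epsilon>"
  shows "(\<integral>x. norm (\<phi> x) \<partial>lebesgue_on \<Omega>) \<le> \<epsilon> * (1 + measure lebesgue \<Omega>)"
proof -
  have const: "integrable (lebesgue_on \<Omega>) (\<lambda>x. \<epsilon>)"
    by (rule finite_measure.integrable_const[OF finite_measure_lebesgue_on[OF \<Omega>]])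
  have sq: "integrable (lebesgue_on \<Omega>) (\<lambda>x. (norm (\<phi> x))\<^sup>2)" using \<phi> by (simp add: L2_fields_def)
  \<comment> \<open>This elementary inequality replaces the Cauchy-Schwarz inequality; the constant is immaterial.\<close>
  have le: "t \<le> \<epsilon> + t\<^sup>2 / \<epsilon>" for t :: real
  proof -
    have "2 * (t * \<epsilon>) \<le> t\<^sup>2 + \<epsilon>\<^sup>2"
      using zero_le_power2[of "t - \<epsilon>"] by (simp add: power2_diff)
    then have "t * \<epsilon> \<le> \<epsilon>\<^sup>2 + t\<^sup>2"
      using zero_le_power2[of t] zero_le_power2[of \<epsilon>] by linarith
    then show ?thesis using \<open>\<epsilon> > 0\<close> by (simp add: field_simps power2_eq_square)
  qed
  have "(\<integral>x. norm (\<phi> x) \<partial>lebesgue_on \<Omega>) \<le> (\<integral>x. \<epsilon> + (norm (\<phi> x))\<^sup>2 / \<epsilon> \<partial>lebesgue_on \<Omega>)"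
    using sq const L2_fields_integrable[OF \<phi> \<Omega>] le by (intro integral_mono) auto
  also have "\<dots> = \<epsilon> * measure lebesgue \<Omega> + (\<integral>x. (norm (\<phi> x))\<^sup>2 \<partial>lebesgue_on \<Omega>) / \<epsilon>"
    using sq const \<Omega> by (simp add: measure_restrict_space)
  also have "(\<integral>x. (norm (\<phi> x))\<^sup>2 \<partial>lebesgue_on \<Omega>) = (L2_norm \<Omega> \<phi>)\<^sup>2"
    by (simp add: L2_norm_def)
  also have "(L2_norm \<Omega> \<phi>)\<^sup>2 / \<epsilon> \<le> \<epsilon>\<^sup>2 / \<epsilon>"
    using assms by (intro divide_right_mono power_mono) (auto simp: L2_norm_def)
  finally show ?thesis using \<open>\<epsilon> > 0\<close> by (simp add: algebra_simps power2_eq_square)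
qed

lemma L2_fields_diff:
  assumes "\<phi> \<in> L2_fields \<Omega>" "\<psi> \<in> L2_fields \<Omega>"
  shows "(\<lambda>x. \<phi> x - \<psi> x) \<in> L2_fields \<Omega>"
proof -
  have m: "(\<lambda>x. \<phi> x - \<psi> x) \<in> borel_measurable (lebesgue_on \<Omega>)"
    using assms by (auto simp: L2_fields_def)
  have le: "(norm (a - b))\<^sup>2 \<le> 2 * (norm a)\<^sup>2 + 2 * (norm b)\<^sup>2" for a b :: "real^3"
  proof -
    have "(norm (a - b))\<^sup>2 \<le> (norm a + norm b)\<^sup>2"
      by (intro power_mono norm_triangle_ineq4 norm_ge_zero)
    also have "\<dots> \<le> 2 * (norm a)\<^sup>2 + 2 * (norm b)\<^sup>2"
      using zero_le_power2[of "norm a - norm b"] by (simp add: power2_diff power2_sum)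
    finally show ?thesis .
  qed
  have "integrable (lebesgue_on \<Omega>) (\<lambda>x. (norm (\<phi> x - \<psi> x))\<^sup>2)"
  proof (rule Bochner_Integration.integrable_bound)
    show "integrable (lebesgue_on \<Omega>) (\<lambda>x. 2 * (norm (\<phi> x))\<^sup>2 + 2 * (norm (\<psi> x))\<^sup>2)"
      using assms by (auto simp: L2_fields_def)
    show "(\<lambda>x. (norm (\<phi> x - \<psi> x))\<^sup>2) \<in> borel_measurable (lebesgue_on \<Omega>)"
      using m by simp
  qed (use le in \<open>auto intro!: AE_I2 order_trans[OF le abs_ge_self]\<close>)
  with m show ?thesis by (simp add: L2_fields_def)
qed

section \<open>Uniqueness of the weak rotation\<close>

lemma box_bump_test_field:
  assumes "cbox a b \<subseteq> \<Omega>"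
  shows "(\<lambda>x. box_bump a b n x *\<^sub>R axis m 1) \<in> test_fields \<Omega>"
proof -
  have "closure {x. box_bump a b n x *\<^sub>R axis m (1::real) \<noteq> 0} \<subseteq> cbox a b"
    by (intro closure_minimal) (use box_subset_cbox[of a b] in \<open>auto simp: box_bump_nonzero_iff axis_eq_0_iff\<close>)
  moreover from this have "compact (closure {x. box_bump a b n x *\<^sub>R axis m (1::real) \<noteq> 0})"
    by (meson bounded_cbox bounded_subset closed_closure compact_eq_bounded_closed)
  ultimately show ?thesis
    using assms unfolding test_fields_def
    by (auto intro!: continuously_differentiable_bounded_linear[OF bounded_linear_scaleR_left]
        continuously_differentiable_box_bump)
qed

lemma weak_rot_unique:
  assumes "open \<Omega>" "bounded \<Omega>" "has_weak_rot \<Omega> \<phi> \<psi>" "has_weak_rot \<Omega> \<phi> \<psi>'"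
  shows "AE x in lebesgue_on \<Omega>. \<psi> x = \<psi>' x"
proof -
  have \<Omega>: "\<Omega> \<in> lmeasurable" using assms by (intro lmeasurable_open)
  have i: "integrable (lebesgue_on \<Omega>) (\<lambda>x. \<psi> x $ m)" "integrable (lebesgue_on \<Omega>) (\<lambda>x. \<psi>' x $ m)" for m
    using assms \<Omega> by (auto intro: L2_fields_component_integrable simp: has_weak_rot_def)
  have "AE x in lebesgue_on \<Omega>. \<psi> x $ m - \<psi>' x $ m = 0" for m
  proof (rule AE_zero_if_box_integrals_zero[OF \<open>open \<Omega>\<close>])
    show id: "integrable (lebesgue_on \<Omega>) (\<lambda>x. \<psi> x $ m - \<psi>' x $ m)" using i by simp
    fix a b assume ab: "cbox a b \<subseteq> \<Omega>"
    have bm: "box_bump a b n \<in> borel_measurable (lebesgue_on \<Omega>)" for n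
      using continuously_differentiable_continuous[OF continuously_differentiable_box_bump]
      by (intro measurable_restrict_space1 measurable_completion)
         (auto intro: borel_measurable_continuous_onI)
    have bi: "integrable (lebesgue_on \<Omega>) (\<lambda>x. box_bump a b n x * f x)"
      if "integrable (lebesgue_on \<Omega>) f" for n and f :: "real^3 \<Rightarrow> real"
    proof (rule Bochner_Integration.integrable_bound[OF that])
      show "(\<lambda>x. box_bump a b n x * f x) \<in> borel_measurable (lebesgue_on \<Omega>)"
        using bm that by auto
    qed (auto simp: abs_mult box_bump_bounds mult_left_le_one_le)
    have zero: "(\<integral>x. box_bump a b n x * (\<psi> x $ m - \<psi>' x $ m) \<partial>lebesgue_on \<Omega>) = 0" for n
    proof -
      note t = box_bump_test_field[OF ab, of n m]
      have "(\<integral>x. \<psi> x \<bullet> (box_bump a b n x *\<^sub>R axis m 1) \<partial>lebesgue_on \<Omega>) =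
          (\<integral>x. \<psi>' x \<bullet> (box_bump a b n x *\<^sub>R axis m 1) \<partial>lebesgue_on \<Omega>)"
        using assms(3,4) t by (simp add: has_weak_rot_def del: inner_scaleR_right)
      then show ?thesis
        using bi[OF i(1)[of m]] bi[OF i(2)[of m]] by (simp add: inner_axis algebra_simps)
    qed
    have "(\<lambda>n. \<integral>x. box_bump a b n x * (\<psi> x $ m - \<psi>' x $ m) \<partial>lebesgue_on \<Omega>) \<longlonglongrightarrow>
        (\<integral>x. indicator (box a b) x * (\<psi> x $ m - \<psi>' x $ m) \<partial>lebesgue_on \<Omega>)"
    proof (rule integral_dominated_convergence[where w = "\<lambda>x. \<bar>\<psi> x $ m - \<psi>' x $ m\<bar>"])
      show "integrable (lebesgue_on \<Omega>) (\<lambda>x. \<bar>\<psi> x $ m - \<psi>' x $ m\<bar>)" using id by simp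
      show "(\<lambda>x. indicator (box a b) x * (\<psi> x $ m - \<psi>' x $ m)) \<in> borel_measurable (lebesgue_on \<Omega>)"
      proof (rule borel_measurable_times)
        show "indicator (box a b) \<in> borel_measurable (lebesgue_on \<Omega>)"
          by (intro measurable_restrict_space1 measurable_completion) auto
      qed (use id in auto)
      show "AE x in lebesgue_on \<Omega>. (\<lambda>n. box_bump a b n x * (\<psi> x $ m - \<psi>' x $ m)) \<longlonglongrightarrow> indicator (box a b) x * (\<psi> x $ m - \<psi>' x $ m)"
        by (intro AE_I2 tendsto_mult box_bump_tendsto_indicator tendsto_const)
      show "(\<lambda>x. box_bump a b n x * (\<psi> x $ m - \<psi>' x $ m)) \<in> borel_measurable (lebesgue_on \<Omega>)" for n
        using bm id by (intro borel_measurable_times) auto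
      show "AE x in lebesgue_on \<Omega>. norm (box_bump a b n x * (\<psi> x $ m - \<psi>' x $ m)) \<le> \<bar>\<psi> x $ m - \<psi>' x $ m\<bar>" for n
        by (intro AE_I2) (simp add: abs_mult box_bump_bounds mult_left_le_one_le)
    qed
    then show "(\<integral>x. indicator (box a b) x * (\<psi> x $ m - \<psi>' x $ m) \<partial>lebesgue_on \<Omega>) = 0"
      by (simp only: zero LIMSEQ_const_iff)
  qed
  then have "AE x in lebesgue_on \<Omega>. \<forall>m\<in>(UNIV :: 3 set). \<psi> x $ m - \<psi>' x $ m = 0"
    by (subst AE_finite_all) simp_all
  then show ?thesis by eventually_elim (simp add: vec_eq_iff)
qed

section \<open>Derivatives and integrals of test fields\<close>

lemma test_field_derivative:
  assumes "\<theta> \<in> test_fields \<Omega>"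
  shows "(\<theta> has_derivative frechet_derivative \<theta> (at x)) (at x)"
    and "continuous_on UNIV (\<lambda>x. frechet_derivative \<theta> (at x) v)"
    and "continuous_on UNIV \<theta>"
proof -
  have c: "continuously_differentiable (Suc 0) \<theta>" "continuously_differentiable 0 \<theta>"
    using assms unfolding test_fields_def by blast+
  show "(\<theta> has_derivative frechet_derivative \<theta> (at x)) (at x)"
    by (rule continuously_differentiable_SucD(1)[OF c(1)])
  show "continuous_on UNIV (\<lambda>x. frechet_derivative \<theta> (at x) v)"
    using continuously_differentiable_SucD(2)[OF c(1)] by simp
  show "continuous_on UNIV \<theta>" using c(2) by simp
qed

lemma partial_deriv_component:
  assumes "(\<theta> has_derivative \<theta>') (at x)"
  shows "partial_deriv m (\<lambda>y. \<theta> y $ p) x = \<theta>' (axis m 1) $ p"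
  using frechet_derivative_at[OF bounded_linear.has_derivative[OF bounded_linear_vec_nth assms, of p]]
  unfolding partial_deriv_def by (simp add: fun_eq_iff)

lemma test_field_partial_deriv:
  assumes "\<theta> \<in> test_fields \<Omega>"
  shows "((\<lambda>t. \<theta> (x + t *\<^sub>R axis m 1) $ p) has_real_derivative partial_deriv m (\<lambda>y. \<theta> y $ p) x) (at 0)"
    and "continuous_on UNIV (partial_deriv m (\<lambda>y. \<theta> y $ p))"
proof -
  note d = test_field_derivative[OF assms]
  let ?D = "frechet_derivative \<theta> (at x)"
  have "((\<lambda>t. x + t *\<^sub>R axis m 1) has_derivative (\<lambda>t. t *\<^sub>R axis m 1)) (at (0::real))"
    using has_derivative_add[OF has_derivative_const[of x]
        bounded_linear_imp_has_derivative[OF bounded_linear_scaleR_left[of "axis m 1"]]] by simp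
  moreover have "(\<theta> has_derivative ?D) (at (x + 0 *\<^sub>R axis m 1))" using d(1) by simp
  ultimately have "((\<lambda>t. \<theta> (x + t *\<^sub>R axis m 1)) has_derivative (\<lambda>t. ?D (t *\<^sub>R axis m 1))) (at 0)"
    by (rule has_derivative_compose)
  from bounded_linear.has_derivative[OF bounded_linear_vec_nth this, of p]
  show "((\<lambda>t. \<theta> (x + t *\<^sub>R axis m 1) $ p) has_real_derivative partial_deriv m (\<lambda>y. \<theta> y $ p) x) (at 0)"
    unfolding has_field_derivative_def partial_deriv_component[OF d(1)]
    by (simp add: linear_cmul[OF has_derivative_linear[OF d(1)]] mult_commute_abs)
  show "continuous_on UNIV (partial_deriv m (\<lambda>y. \<theta> y $ p))"
    unfolding partial_deriv_component[OF d(1)]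
    by (intro continuous_on_component d(2))
qed

lemma partial_deriv_eq_0:
  assumes "x \<notin> closure {x. \<theta> x \<noteq> 0}"
  shows "partial_deriv m (\<lambda>y. \<theta> y $ p) x = 0"
proof -
  have "(\<theta> has_derivative (\<lambda>v. 0)) (at x)"
  proof (rule has_derivative_transform_within_open)
    show "((\<lambda>x. 0) has_derivative (\<lambda>v. 0)) (at x)" by (rule has_derivative_const)
    show "open (- closure {x. \<theta> x \<noteq> 0})" by (simp add: open_Compl)
    show "x \<in> - closure {x. \<theta> x \<noteq> 0}" using assms by simp
    show "0 = \<theta> y" if "y \<in> - closure {x. \<theta> x \<noteq> 0}" for y
      using that closure_subset[of "{x. \<theta> x \<noteq> 0}"] by auto
  qed
  from partial_deriv_component[OF this] show ?thesis by simp
qed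

lemma test_field_support:
  assumes "\<theta> \<in> test_fields \<Omega>" "x \<notin> \<Omega>"
  shows "\<theta> x = 0" "partial_deriv m (\<lambda>y. \<theta> y $ p) x = 0"
proof -
  have x: "x \<notin> closure {x. \<theta> x \<noteq> 0}" using assms by (auto simp: test_fields_def)
  show "\<theta> x = 0" using x closure_subset[of "{x. \<theta> x \<noteq> 0}"] by auto
  show "partial_deriv m (\<lambda>y. \<theta> y $ p) x = 0" by (rule partial_deriv_eq_0[OF x])
qed

lemma classical_rot_component:
  "classical_rot \<theta> x $ 1 = partial_deriv 2 (\<lambda>y. \<theta> y $ 3) x - partial_deriv 3 (\<lambda>y. \<theta> y $ 2) x"
  "classical_rot \<theta> x $ 2 = partial_deriv 3 (\<lambda>y. \<theta> y $ 1) x - partial_deriv 1 (\<lambda>y. \<theta> y $ 3) x"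
  "classical_rot \<theta> x $ 3 = partial_deriv 1 (\<lambda>y. \<theta> y $ 2) x - partial_deriv 2 (\<lambda>y. \<theta> y $ 1) x"
  by (simp_all add: classical_rot_def)

lemma classical_rot_eq_0:
  assumes "\<theta> \<in> test_fields \<Omega>" "x \<notin> \<Omega>"
  shows "classical_rot \<theta> x = 0"
  using test_field_support(2)[OF assms]
  by (simp add: vec_eq_iff forall_3 classical_rot_component)

lemma continuous_on_classical_rot:
  assumes "\<theta> \<in> test_fields \<Omega>"
  shows "continuous_on UNIV (classical_rot \<theta>)"
proof -
  have "continuous_on UNIV (\<lambda>x. classical_rot \<theta> x $ m)" for m
    using exhaust_3[of m]
    by (elim disjE; simp only: classical_rot_component)
       (intro continuous_on_diff test_field_partial_deriv(2)[OF assms])+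
  then have "continuous_on UNIV (\<lambda>x. \<chi> m. classical_rot \<theta> x $ m)"
    by (rule continuous_on_vec_lambda)
  then show ?thesis by simp
qed

lemma continuous_vanishing_bounded:
  fixes f :: "real^3 \<Rightarrow> 'b::euclidean_space"
  assumes f: "continuous_on UNIV f" and vanish: "\<And>x. x \<notin> \<Omega> \<Longrightarrow> f x = 0" and "bounded \<Omega>"
  obtains B where "\<And>x. norm (f x) \<le> B"
proof -
  have "compact (f ` closure \<Omega>)"
    using \<open>bounded \<Omega>\<close>
    by (intro compact_continuous_image continuous_on_subset[OF f]) (auto simp: compact_closure)
  from compact_imp_bounded[OF this] obtain B where B: "\<And>x. x \<in> closure \<Omega> \<Longrightarrow> norm (f x) \<le> B"
    unfolding bounded_iff by blast
  have "norm (f x) \<le> max B 0" for x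
    using B[of x] vanish[of x] closure_subset[of \<Omega>] by (cases "x \<in> \<Omega>") auto
  then show ?thesis by (rule that)
qed

lemma integrable_continuous_vanishing:
  fixes f :: "real^3 \<Rightarrow> 'b::euclidean_space"
  assumes f: "continuous_on UNIV f" and vanish: "\<And>x. x \<notin> \<Omega> \<Longrightarrow> f x = 0"
    and "bounded \<Omega>" "open \<Omega>"
  shows "integrable lborel f"
proof -
  obtain B where B: "\<And>x. norm (f x) \<le> B"
    using continuous_vanishing_bounded[OF f vanish \<open>bounded \<Omega>\<close>] by blast
  show ?thesis
  proof (rule Bochner_Integration.integrable_bound)
    have "emeasure lborel \<Omega> < \<infinity>" using \<open>bounded \<Omega>\<close> by (rule emeasure_bounded_finite)
    then show "integrable lborel (\<lambda>x. B * indicator \<Omega> x)"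
      using \<open>open \<Omega>\<close> by (intro integrable_mult_right integrable_real_indicator) auto
    show "f \<in> borel_measurable lborel" using f by (auto intro: borel_measurable_continuous_onI)
    show "AE x in lborel. norm (f x) \<le> norm (B * indicator \<Omega> x :: real)"
      using B vanish by (auto intro!: AE_I2 simp: indicator_def intro: order_trans[OF B abs_ge_self])
  qed
qed

lemma integral_lebesgue_on_vanishing:
  fixes f :: "real^3 \<Rightarrow> real"
  assumes "f \<in> borel_measurable borel" "\<And>x. x \<notin> \<Omega> \<Longrightarrow> f x = 0" "open \<Omega>"
  shows "(\<integral>x. f x \<partial>lebesgue_on \<Omega>) = (\<integral>x. f x \<partial>lborel)"
proof -
  have "(\<integral>x. f x \<partial>lebesgue_on \<Omega>) = (\<integral>x. indicator \<Omega> x *\<^sub>R f x \<partial>lebesgue)"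
    using \<open>open \<Omega>\<close> by (subst integral_restrict_space) auto
  also have "(\<lambda>x. indicator \<Omega> x *\<^sub>R f x) = f"
    using assms(2) by (auto simp: indicator_def fun_eq_iff)
  also have "(\<integral>x. f x \<partial>lebesgue) = (\<integral>x. f x \<partial>lborel)"
    using assms(1) by (intro integral_completion) simp
  finally show ?thesis .
qed

lemma continuous_vanishing_L2:
  assumes f: "continuous_on UNIV f" and vanish: "\<And>x. x \<notin> \<Omega> \<Longrightarrow> f x = 0"
    and "bounded \<Omega>" "open \<Omega>"
  shows "f \<in> L2_fields \<Omega>"
proof -
  have fin: "finite_measure (lebesgue_on \<Omega>)"
    by (rule finite_measure_lebesgue_on) (use assms in \<open>simp add: lmeasurable_open\<close>)
  obtain B where B: "\<And>x. norm (f x) \<le> B"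
    using continuous_vanishing_bounded[OF f vanish \<open>bounded \<Omega>\<close>] by blast
  have m: "f \<in> borel_measurable (lebesgue_on \<Omega>)"
    using f by (intro measurable_restrict_space1 measurable_completion)
       (auto intro: borel_measurable_continuous_onI)
  have "integrable (lebesgue_on \<Omega>) (\<lambda>x. (norm (f x))\<^sup>2)"
  proof (rule finite_measure.integrable_const_bound[OF fin, where B = "B\<^sup>2"])
    show "AE x in lebesgue_on \<Omega>. norm ((norm (f x))\<^sup>2) \<le> B\<^sup>2"
      using B by (intro AE_I2) (simp add: power_mono)
  qed (use m in simp)
  with m show ?thesis by (simp add: L2_fields_def)
qed

lemma test_field_norm_bound:
  assumes "\<theta> \<in> test_fields \<Omega>"
  obtains r where "\<And>x. norm x > r \<Longrightarrow> \<theta> x = 0"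
proof -
  have "bounded (closure {x. \<theta> x \<noteq> 0})"
    using assms by (auto simp: test_fields_def intro: compact_imp_bounded)
  then obtain r where r: "\<And>x. x \<in> closure {x. \<theta> x \<noteq> 0} \<Longrightarrow> norm x \<le> r"
    unfolding bounded_iff by blast
  have "\<theta> x = 0" if "norm x > r" for x
    using r[of x] that closure_subset[of "{x. \<theta> x \<noteq> 0}"] by force
  then show ?thesis by (rule that)
qed

section \<open>Weak rotations of test fields and of differences\<close>

text \<open>The integrand is the derivative of the product \<open>\<theta>\<^sub>p \<eta>\<^sub>q\<close> in direction \<open>m\<close>.\<close>

lemma test_fields_integration_by_parts:
  assumes \<theta>: "\<theta> \<in> test_fields \<Omega>" and \<eta>: "\<eta> \<in> test_fields \<Omega>" and \<Omega>: "open \<Omega>" "bounded \<Omega>"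
  shows "integrable lborel (\<lambda>x. partial_deriv m (\<lambda>y. \<theta> y $ p) x * \<eta> x $ q + partial_deriv m (\<lambda>y. \<eta> y $ q) x * \<theta> x $ p)"
      (is "integrable lborel ?u'")
    and "(\<integral>x. partial_deriv m (\<lambda>y. \<theta> y $ p) x * \<eta> x $ q + partial_deriv m (\<lambda>y. \<eta> y $ q) x * \<theta> x $ p \<partial>lborel) = 0"
proof -
  note d\<theta> = test_field_partial_deriv(1)[OF \<theta>, of _ m p] test_field_partial_deriv(2)[OF \<theta>, of m p]
  note d\<eta> = test_field_partial_deriv(1)[OF \<eta>, of _ m q] test_field_partial_deriv(2)[OF \<eta>, of m q]
  note c = test_field_derivative(3)[OF \<theta>] test_field_derivative(3)[OF \<eta>]
  have c': "continuous_on UNIV ?u'"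
    by (intro continuous_on_add continuous_on_mult d\<theta>(2) d\<eta>(2) continuous_on_component c)
  then show "integrable lborel ?u'"
    by (rule integrable_continuous_vanishing[where \<Omega> = \<Omega>])
       (simp_all add: \<Omega> test_field_support[OF \<theta>] test_field_support[OF \<eta>])
  obtain r where r: "\<And>x. norm x > r \<Longrightarrow> \<theta> x = 0" using test_field_norm_bound[OF \<theta>] by blast
  \<comment> \<open>The weight is the constant \<open>1\<close>, whose derivative is \<open>0\<close>.\<close>
  have "(\<integral>x. 1 * ?u' x \<partial>lborel) = - (\<integral>x. 0 * (\<theta> x $ p * \<eta> x $ q) \<partial>lborel)"
  proof (rule integral_mult_directional_derivative[where e = "axis m 1" and r = r and K = 1 and L = 0])
    show "((\<lambda>t. \<theta> (x + t *\<^sub>R axis m 1) $ p * \<eta> (x + t *\<^sub>R axis m 1) $ q) has_real_derivative ?u' x) (at 0)" for x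
      using DERIV_mult[OF d\<theta>(1) d\<eta>(1), of x x] by simp
    show "continuous_on UNIV (\<lambda>x. \<theta> x $ p * \<eta> x $ q)"
      by (intro continuous_on_mult continuous_on_component c)
  qed (use c' r in auto)
  then show "(\<integral>x. ?u' x \<partial>lborel) = 0" by simp
qed

lemma has_weak_rot_classical_rot:
  assumes \<theta>: "\<theta> \<in> test_fields \<Omega>" and \<Omega>: "open \<Omega>" "bounded \<Omega>"
  shows "has_weak_rot \<Omega> \<theta> (classical_rot \<theta>)"
  unfolding has_weak_rot_def
proof (intro conjI ballI)
  show "classical_rot \<theta> \<in> L2_fields \<Omega>"
    by (rule continuous_vanishing_L2[OF continuous_on_classical_rot[OF \<theta>] classical_rot_eq_0[OF \<theta>] \<Omega>(2,1)])
  fix \<eta> assume \<eta>: "\<eta> \<in> test_fields \<Omega>"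
  let ?P = "\<lambda>m p q x. partial_deriv m (\<lambda>y. \<theta> y $ p) x * \<eta> x $ q + partial_deriv m (\<lambda>y. \<eta> y $ q) x * \<theta> x $ p"
  note P = test_fields_integration_by_parts[OF \<theta> \<eta> \<Omega>]
  have c: "continuous_on UNIV (\<lambda>x. \<theta> x \<bullet> classical_rot \<eta> x)" "continuous_on UNIV (\<lambda>x. classical_rot \<theta> x \<bullet> \<eta> x)"
    by (intro continuous_on_inner test_field_derivative(3)[OF \<theta>] test_field_derivative(3)[OF \<eta>]
        continuous_on_classical_rot[OF \<theta>] continuous_on_classical_rot[OF \<eta>])+
  have z: "\<theta> x \<bullet> classical_rot \<eta> x = 0" "classical_rot \<theta> x \<bullet> \<eta> x = 0" if "x \<notin> \<Omega>" for x
    using test_field_support(1)[OF \<theta> that] test_field_support(1)[OF \<eta> that] by simp_all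
  note i = integrable_continuous_vanishing[OF c(1) z(1) \<Omega>(2,1)]
    integrable_continuous_vanishing[OF c(2) z(2) \<Omega>(2,1)]
  have "(\<integral>x. \<theta> x \<bullet> classical_rot \<eta> x \<partial>lborel) - (\<integral>x. classical_rot \<theta> x \<bullet> \<eta> x \<partial>lborel) =
      (\<integral>x. \<theta> x \<bullet> classical_rot \<eta> x - classical_rot \<theta> x \<bullet> \<eta> x \<partial>lborel)"
    using i by simp
  \<comment> \<open>The integrand is minus the divergence of the cross product of \<open>\<theta>\<close> and \<open>\<eta>\<close>, written as six
    derivatives of products.\<close>
  also have "\<dots> = (\<integral>x. ?P 2 1 3 x - ?P 2 3 1 x + ?P 3 2 1 x - ?P 3 1 2 x + ?P 1 3 2 x - ?P 1 2 3 x \<partial>lborel)"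
    by (intro Bochner_Integration.integral_cong refl)
       (simp only: inner_vec_def sum_3 classical_rot_component inner_real_def, simp only: algebra_simps)
  also have "\<dots> = 0"
    by (simp only: Bochner_Integration.integral_add Bochner_Integration.integral_diff
        Bochner_Integration.integrable_add Bochner_Integration.integrable_diff P)
  finally have "(\<integral>x. \<theta> x \<bullet> classical_rot \<eta> x \<partial>lborel) = (\<integral>x. classical_rot \<theta> x \<bullet> \<eta> x \<partial>lborel)" by simp
  then show "(\<integral>x. \<theta> x \<bullet> classical_rot \<eta> x \<partial>lebesgue_on \<Omega>) = (\<integral>x. classical_rot \<theta> x \<bullet> \<eta> x \<partial>lebesgue_on \<Omega>)"
    using integral_lebesgue_on_vanishing[OF borel_measurable_continuous_onI[OF c(1)] z(1) \<Omega>(1)]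
      integral_lebesgue_on_vanishing[OF borel_measurable_continuous_onI[OF c(2)] z(2) \<Omega>(1)] by simp
qed

lemma has_weak_rot_diff:
  assumes \<Omega>: "open \<Omega>" "bounded \<Omega>" and L2: "\<phi> \<in> L2_fields \<Omega>" "\<phi>' \<in> L2_fields \<Omega>"
    and rot: "has_weak_rot \<Omega> \<phi> \<psi>" "has_weak_rot \<Omega> \<phi>' \<psi>'"
  shows "has_weak_rot \<Omega> (\<lambda>x. \<phi> x - \<phi>' x) (\<lambda>x. \<psi> x - \<psi>' x)"
  unfolding has_weak_rot_def
proof (intro conjI ballI)
  have lm: "\<Omega> \<in> lmeasurable" using \<Omega> by (intro lmeasurable_open)
  have L2': "\<psi> \<in> L2_fields \<Omega>" "\<psi>' \<in> L2_fields \<Omega>" using rot by (auto simp: has_weak_rot_def)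
  then show "(\<lambda>x. \<psi> x - \<psi>' x) \<in> L2_fields \<Omega>" by (rule L2_fields_diff)
  \<comment> \<open>Needed to split the integrals: the second factor is bounded.\<close>
  have int: "integrable (lebesgue_on \<Omega>) (\<lambda>x. f x \<bullet> \<theta> x)"
    if f: "f \<in> L2_fields \<Omega>" and \<theta>: "continuous_on UNIV \<theta>" "\<And>x. x \<notin> \<Omega> \<Longrightarrow> \<theta> x = 0" for f \<theta>
  proof -
    obtain K where K: "\<And>x. norm (\<theta> x) \<le> K"
      using continuous_vanishing_bounded[OF \<theta> \<Omega>(2)] by blast
    have m: "\<theta> \<in> borel_measurable (lebesgue_on \<Omega>)"
      using continuous_vanishing_L2[OF \<theta> \<Omega>(2,1)] by (simp add: L2_fields_def)
    show ?thesis
    proof (rule Bochner_Integration.integrable_bound)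
      show "integrable (lebesgue_on \<Omega>) (\<lambda>x. norm (f x) * K)"
        by (intro integrable_mult_left integrable_norm L2_fields_integrable[OF f lm])
      show "(\<lambda>x. f x \<bullet> \<theta> x) \<in> borel_measurable (lebesgue_on \<Omega>)"
        using f m by (intro borel_measurable_inner) (simp_all add: L2_fields_def)
      have "\<bar>f x \<bullet> \<theta> x\<bar> \<le> norm (f x) * K" for x
        by (rule order_trans[OF Cauchy_Schwarz_ineq2 mult_left_mono[OF K norm_ge_zero]])
      then show "AE x in lebesgue_on \<Omega>. norm (f x \<bullet> \<theta> x) \<le> norm (norm (f x) * K)"
        by (intro AE_I2) (simp add: order_trans[OF _ abs_ge_self])
    qed
  qed
  fix \<theta> assume \<theta>: "\<theta> \<in> test_fields \<Omega>"
  note i = int[OF _ test_field_derivative(3)[OF \<theta>] test_field_support(1)[OF \<theta>]]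
    int[OF _ continuous_on_classical_rot[OF \<theta>] classical_rot_eq_0[OF \<theta>]]
  show "(\<integral>x. (\<phi> x - \<phi>' x) \<bullet> classical_rot \<theta> x \<partial>lebesgue_on \<Omega>) =
      (\<integral>x. (\<psi> x - \<psi>' x) \<bullet> \<theta> x \<partial>lebesgue_on \<Omega>)"
    using rot \<theta> i(1)[OF L2'(1)] i(1)[OF L2'(2)] i(2)[OF L2(1)] i(2)[OF L2(2)]
    by (simp add: inner_diff_left has_weak_rot_def)
qed

section \<open>The estimate for test fields\<close>

lemma abs_classical_rot_component:
  assumes "distinct [i, j, k]"
  shows "\<bar>classical_rot \<theta> x $ k\<bar> =
    \<bar>partial_deriv j (\<lambda>y. \<theta> y $ i) x - partial_deriv i (\<lambda>y. \<theta> y $ j) x\<bar>"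
  using assms exhaust_3[of i] exhaust_3[of j] exhaust_3[of k]
  by (elim disjE; simp add: classical_rot_component abs_minus_commute)

text \<open>The estimate with the slab in direction \<open>k\<close> over an arbitrary Borel set \<open>J\<close>. In the
  proof, \<open>W\<close> is the ramp that rises with slope \<open>1\<close> on the interval from \<open>\<alpha>\<close> to \<open>\<beta>\<close> and is constant elsewhere.\<close>

lemma test_field_box_integral_le:
  fixes i j k :: 3 and \<alpha> \<beta> :: real and J :: "real set"
  defines "A \<equiv> {x::real^3. x $ k \<in> J}"
  assumes \<theta>: "\<theta> \<in> test_fields \<Omega>" and \<Omega>: "open \<Omega>" "bounded \<Omega>"
    and ijk: "distinct [i, j, k]" and "\<alpha> < \<beta>" and J: "J \<in> sets borel"
  shows "\<bar>\<integral>x. indicator A x * indicator {\<alpha><..<\<beta>} (x $ j) * \<theta> x $ i \<partial>lborel\<bar>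
    \<le> (\<beta> - \<alpha>) * (\<integral>x. indicator A x * \<bar>classical_rot \<theta> x $ k\<bar> \<partial>lborel)"
proof -
  define W where "W s = min \<beta> (max \<alpha> s) - \<alpha>" for s
  define g where "g x = indicator A x * W (x $ j)" for x :: "real^3"
  have A_m: "A \<in> sets borel"
  proof -
    have "(\<lambda>x::real^3. x $ k) -` J \<inter> space borel \<in> sets borel"
      by (intro measurable_sets[OF _ J] borel_measurable_continuous_onI continuous_on_component continuous_on_id)
    then show ?thesis by (simp add: A_def vimage_def)
  qed
  have nth_m: "(\<lambda>x::real^3. x $ m) \<in> borel_measurable borel" for m
    by (intro borel_measurable_continuous_onI continuous_on_component continuous_on_id)
  have W_m: "W \<in> borel_measurable borel" unfolding W_def[abs_def] by measurable
  have g_m: "g \<in> borel_measurable borel"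
    unfolding g_def[abs_def]
    by (intro borel_measurable_times borel_measurable_indicator A_m measurable_compose[OF nth_m W_m])
  have W_bounds: "0 \<le> W s" "W s \<le> \<beta> - \<alpha>" for s using \<open>\<alpha> < \<beta>\<close> by (auto simp: W_def)
  have g_bound: "\<bar>g x\<bar> \<le> \<beta> - \<alpha>" for x
    using W_bounds \<open>\<alpha> < \<beta>\<close> by (auto simp: g_def indicator_def)
  have W_lip: "\<bar>W s - W (s - h)\<bar> \<le> h" if "h > 0" for s h
    using that by (auto simp: W_def min_def max_def)
  obtain r where r: "\<And>x. norm x > r \<Longrightarrow> \<theta> x = 0" using test_field_norm_bound[OF \<theta>] by blast
  note c = test_field_derivative(3)[OF \<theta>]
  note d = test_field_partial_deriv[OF \<theta>]
  have shift: "x - h *\<^sub>R axis m 1 \<in> A \<longleftrightarrow> x \<in> A" if "m \<noteq> k" for x h m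
    using that by (simp add: A_def axis_def)
  have shift_g: "g x - g (x - h *\<^sub>R axis j 1) = indicator A x * (W (x $ j) - W (x $ j - h))" for x h
    using shift[of j x h] ijk by (simp add: g_def indicator_def axis_def)
  have "(\<integral>x. g x * partial_deriv j (\<lambda>y. \<theta> y $ i) x \<partial>lborel) =
      - (\<integral>x. (indicator A x * indicator {\<alpha><..<\<beta>} (x $ j)) * \<theta> x $ i \<partial>lborel)"
  proof (rule integral_mult_directional_derivative[OF d(1) continuous_on_component[OF c] d(2) _ g_m g_bound,
        where r = r and L = 1])
    show "\<theta> x $ i = 0" if "r < norm x" for x using r[OF that] by simp
    show "\<bar>g x - g (x - h *\<^sub>R axis j 1)\<bar> \<le> 1 * h" if "h > 0" for x h
      unfolding shift_g using W_lip[OF that] that by (auto simp: abs_mult indicator_def)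
    show "(\<lambda>x. indicator A x * indicator {\<alpha><..<\<beta>} (x $ j) :: real) \<in> borel_measurable borel"
      by (intro borel_measurable_times borel_measurable_indicator A_m
          measurable_compose[OF nth_m borel_measurable_indicator]) auto
    have "AE x::real^3 in lborel. x $ j \<noteq> t" for t :: real
      using AE_lborel_inner_neq[of "axis j 1 :: real^3" t] by (simp add: inner_axis axis_in_Basis_iff)
    from this[of \<alpha>] this[of \<beta>]
    show "AE x in lborel. ((\<lambda>h. (g x - g (x - h *\<^sub>R axis j 1)) / h) \<longlongrightarrow>
        indicator A x * indicator {\<alpha><..<\<beta>} (x $ j)) (at_right 0)"
    proof eventually_elim
      case (elim x)
      \<comment> \<open>For steps shorter than \<open>\<delta>\<close> no kink of \<open>W\<close> lies between \<open>x $ j - h\<close> and \<open>x $ j\<close>, so the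
        difference quotient is constant.\<close>
      define \<delta> where "\<delta> = min \<bar>x $ j - \<alpha>\<bar> \<bar>x $ j - \<beta>\<bar>"
      have "0 < \<delta>" using elim by (simp add: \<delta>_def)
      have "eventually (\<lambda>h. h \<in> {0<..<\<delta>}) (at_right 0)" by (rule eventually_at_right_real[OF \<open>0 < \<delta>\<close>])
      then have "eventually (\<lambda>h. indicator A x * indicator {\<alpha><..<\<beta>} (x $ j) =
          (g x - g (x - h *\<^sub>R axis j 1)) / h) (at_right 0)"
      proof eventually_elim
        case (elim h)
        have "W (x $ j) - W (x $ j - h) = indicator {\<alpha><..<\<beta>} (x $ j) * h"
          using elim \<open>\<alpha> < \<beta>\<close> by (auto simp: W_def \<delta>_def indicator_def min_def max_def abs_if split: if_splits)
        then show ?case unfolding shift_g using elim by simp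
      qed
      then show ?case by (rule Lim_transform_eventually[OF tendsto_const])
    qed
  qed
  \<comment> \<open>The weight does not depend on the coordinate \<open>i\<close>.\<close>
  moreover have "(\<integral>x. g x * partial_deriv i (\<lambda>y. \<theta> y $ j) x \<partial>lborel) = - (\<integral>x. 0 * \<theta> x $ j \<partial>lborel)"
  proof (rule integral_mult_directional_derivative[OF d(1) continuous_on_component[OF c] d(2) _ g_m g_bound,
        where r = r and L = 0])
    have "g (x - h *\<^sub>R axis i 1) = g x" for x h
      using shift[of i x h] ijk by (auto simp: g_def indicator_def axis_def)
    then show "\<bar>g x - g (x - h *\<^sub>R axis i 1)\<bar> \<le> 0 * h"
      "AE x in lborel. ((\<lambda>h. (g x - g (x - h *\<^sub>R axis i 1)) / h) \<longlongrightarrow> 0) (at_right 0)" for x h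
      by simp_all
    show "\<theta> x $ j = 0" if "r < norm x" for x using r[OF that] by simp
  qed simp
  moreover have int: "integrable lborel (\<lambda>x. q x * f x)"
    if "continuous_on UNIV f" "\<And>x. x \<notin> \<Omega> \<Longrightarrow> f x = 0" "q \<in> borel_measurable borel"
      "\<And>x. \<bar>q x\<bar> \<le> K" for q f :: "real^3 \<Rightarrow> real" and K
  proof (rule Bochner_Integration.integrable_bound)
    show "integrable lborel (\<lambda>x. K * f x)"
      by (intro integrable_mult_right integrable_continuous_vanishing[OF that(1,2) \<Omega>(2,1)])
    show "(\<lambda>x. q x * f x) \<in> borel_measurable lborel"
      using that(3) borel_measurable_continuous_onI[OF that(1)] by simp
    show "AE x in lborel. norm (q x * f x) \<le> norm (K * f x)"
      by (intro AE_I2) (simp add: abs_mult mult_right_mono order_trans[OF that(4) abs_ge_self])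
  qed
  ultimately have "(\<integral>x. indicator A x * indicator {\<alpha><..<\<beta>} (x $ j) * \<theta> x $ i \<partial>lborel) =
      - (\<integral>x. g x * (partial_deriv j (\<lambda>y. \<theta> y $ i) x - partial_deriv i (\<lambda>y. \<theta> y $ j) x) \<partial>lborel)"
    by (simp add: right_diff_distrib int[OF d(2) test_field_support(2)[OF \<theta>] g_m g_bound])
  also have "\<bar>\<dots>\<bar> \<le> (\<integral>x. (\<beta> - \<alpha>) * (indicator A x * \<bar>classical_rot \<theta> x $ k\<bar>) \<partial>lborel)"
    unfolding abs_minus_cancel
  proof (rule order_trans[OF integral_abs_bound], rule integral_mono)
    have cd: "continuous_on UNIV (\<lambda>x. partial_deriv j (\<lambda>y. \<theta> y $ i) x - partial_deriv i (\<lambda>y. \<theta> y $ j) x)"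
      by (intro continuous_on_diff d(2))
    show "integrable lborel (\<lambda>x. \<bar>g x * (partial_deriv j (\<lambda>y. \<theta> y $ i) x - partial_deriv i (\<lambda>y. \<theta> y $ j) x)\<bar>)"
      by (intro integrable_abs int[OF cd _ g_m g_bound]) (simp add: test_field_support(2)[OF \<theta>])
    show "integrable lborel (\<lambda>x. (\<beta> - \<alpha>) * (indicator A x * \<bar>classical_rot \<theta> x $ k\<bar>))"
    proof (rule integrable_mult_right, rule int[where K = 1])
      show "continuous_on UNIV (\<lambda>x. \<bar>classical_rot \<theta> x $ k\<bar>)"
        by (intro continuous_on_rabs continuous_on_component continuous_on_classical_rot[OF \<theta>])
    qed (use A_m in \<open>auto simp: classical_rot_eq_0[OF \<theta>] indicator_def\<close>)
    fix x
    have "\<bar>g x\<bar> \<le> (\<beta> - \<alpha>) * indicator A x"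
      using W_bounds by (auto simp: g_def indicator_def)
    from mult_right_mono[OF this abs_ge_zero[of "classical_rot \<theta> x $ k"]]
    show "\<bar>g x * (partial_deriv j (\<lambda>y. \<theta> y $ i) x - partial_deriv i (\<lambda>y. \<theta> y $ j) x)\<bar>
        \<le> (\<beta> - \<alpha>) * (indicator A x * \<bar>classical_rot \<theta> x $ k\<bar>)"
      by (simp add: abs_mult abs_classical_rot_component[OF ijk, symmetric] mult.assoc)
  qed
  finally show ?thesis by simp
qed

section \<open>Passage to the closure of the test fields\<close>

lemma integral_lebesgue_on_subset:
  fixes f :: "'a::euclidean_space \<Rightarrow> real"
  assumes "S \<in> sets lebesgue" "\<Omega> \<in> sets lebesgue" "S \<subseteq> \<Omega>"
  shows "(\<integral>x. f x \<partial>lebesgue_on S) = (\<integral>x. indicator S x * f x \<partial>lebesgue_on \<Omega>)"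
proof -
  have "(\<lambda>x. indicator \<Omega> x *\<^sub>R (indicator S x * f x)) = (\<lambda>x. indicator S x *\<^sub>R f x)"
    using assms(3) by (auto simp: indicator_def fun_eq_iff)
  then show ?thesis using assms by (simp add: integral_restrict_space)
qed

theorem theorem2:
  fixes \<Omega> :: "(real^3) set" and l :: "real^3"
    and \<phi> :: "real^3 \<Rightarrow> real^3"
    and i j k :: 3
    and \<alpha>\<^sub>j \<beta>\<^sub>j \<alpha>\<^sub>k \<beta>\<^sub>k :: real
  assumes "open \<Omega>" "connected \<Omega>" "\<Omega> \<noteq> {}" "bounded \<Omega>"
    and "smallest_box \<Omega> l"
    and "\<phi> \<in> R0_space \<Omega>"
    and "distinct [i, j, k]"
    and "0 \<le> \<alpha>\<^sub>j" "\<alpha>\<^sub>j < \<beta>\<^sub>j" "\<beta>\<^sub>j \<le> l $ j"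
    and "0 \<le> \<alpha>\<^sub>k" "\<alpha>\<^sub>k < \<beta>\<^sub>k" "\<beta>\<^sub>k \<le> l $ k"
  shows "\<bar>\<integral>x. \<phi> x $ i \<partial>lebesgue_on {x \<in> \<Omega>. \<alpha>\<^sub>j < x $ j \<and> x $ j < \<beta>\<^sub>j \<and> \<alpha>\<^sub>k < x $ k \<and> x $ k < \<beta>\<^sub>k}\<bar>
    \<le> (\<beta>\<^sub>j - \<alpha>\<^sub>j) * L1_norm {x \<in> \<Omega>. \<alpha>\<^sub>k < x $ k \<and> x $ k < \<beta>\<^sub>k} (\<lambda>x. weak_rot \<Omega> \<phi> x $ k)"
proof -
  note \<Omega> = \<open>open \<Omega>\<close> \<open>bounded \<Omega>\<close>
  have lm: "\<Omega> \<in> lmeasurable" and \<Omega>_m: "\<Omega> \<in> sets lebesgue"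
    using \<Omega> by (auto intro: lmeasurable_open)
  let ?M = "lebesgue_on \<Omega>"
  define A where "A = {x::real^3. x $ k \<in> {\<alpha>\<^sub>k<..<\<beta>\<^sub>k}}"
  define \<Omega>\<^sub>k where "\<Omega>\<^sub>k = {x \<in> \<Omega>. \<alpha>\<^sub>k < x $ k \<and> x $ k < \<beta>\<^sub>k}"
  define \<Omega>\<^sub>j\<^sub>k where "\<Omega>\<^sub>j\<^sub>k = {x \<in> \<Omega>. \<alpha>\<^sub>j < x $ j \<and> x $ j < \<beta>\<^sub>j \<and> \<alpha>\<^sub>k < x $ k \<and> x $ k < \<beta>\<^sub>k}"
  have strip: "open {x::real^3. a < x $ m \<and> x $ m < b}" for a b m
    by (intro open_Collect_conj open_Collect_less continuous_on_component continuous_on_id continuous_on_const)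
  have ind_A: "indicator A x = (indicator \<Omega>\<^sub>k x :: real)"
    and ind_jk: "indicator A x * indicator {\<alpha>\<^sub>j<..<\<beta>\<^sub>j} (x $ j) = (indicator \<Omega>\<^sub>j\<^sub>k x :: real)" if "x \<in> \<Omega>" for x
    using that by (auto simp: A_def \<Omega>\<^sub>k_def \<Omega>\<^sub>j\<^sub>k_def indicator_def)
  have "open \<Omega>\<^sub>k" "open \<Omega>\<^sub>j\<^sub>k"
  proof -
    have "\<Omega>\<^sub>k = \<Omega> \<inter> {x. \<alpha>\<^sub>k < x $ k \<and> x $ k < \<beta>\<^sub>k}"
      "\<Omega>\<^sub>j\<^sub>k = \<Omega> \<inter> {x. \<alpha>\<^sub>j < x $ j \<and> x $ j < \<beta>\<^sub>j} \<inter> {x. \<alpha>\<^sub>k < x $ k \<and> x $ k < \<beta>\<^sub>k}"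
      by (auto simp: \<Omega>\<^sub>k_def \<Omega>\<^sub>j\<^sub>k_def)
    then show "open \<Omega>\<^sub>k" "open \<Omega>\<^sub>j\<^sub>k" using strip \<Omega> by (simp_all add: open_Int)
  qed
  then have sub_m: "\<Omega>\<^sub>k \<in> sets lebesgue" "\<Omega>\<^sub>j\<^sub>k \<in> sets lebesgue" by auto
  have sub: "\<Omega>\<^sub>k \<subseteq> \<Omega>" "\<Omega>\<^sub>j\<^sub>k \<subseteq> \<Omega>" by (auto simp: \<Omega>\<^sub>k_def \<Omega>\<^sub>j\<^sub>k_def)
  have sub_M: "\<Omega>\<^sub>k \<in> sets ?M" "\<Omega>\<^sub>j\<^sub>k \<in> sets ?M"
    using sub sub_m \<Omega>_m by (auto simp: sets_restrict_space_iff)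
  have int_ind: "integrable ?M (\<lambda>x. indicator S x * f x)" if "S \<in> sets ?M" "integrable ?M f"
    for S and f :: "real^3 \<Rightarrow> real"
    using integrable_mult_indicator[OF that] by simp
  define \<psi> where "\<psi> = weak_rot \<Omega> \<phi>"
  have \<phi>: "\<phi> \<in> L2_fields \<Omega>" and \<psi>: "has_weak_rot \<Omega> \<phi> \<psi>"
    using assms(6) someI_ex[of "has_weak_rot \<Omega> \<phi>"]
    by (auto simp: R0_space_def R_space_def weak_rot_def \<psi>_def)
  have \<psi>_L2: "\<psi> \<in> L2_fields \<Omega>" using \<psi> by (simp add: has_weak_rot_def)
  define B C where "B = \<beta>\<^sub>j - \<alpha>\<^sub>j" and "C = 1 + measure lebesgue \<Omega>"
  have "B > 0" "C > 0" using assms by (auto simp: B_def C_def add_pos_nonneg)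
  define X Y where "X = \<bar>\<integral>x. indicator \<Omega>\<^sub>j\<^sub>k x * \<phi> x $ i \<partial>?M\<bar>"
    and "Y = (\<integral>x. indicator \<Omega>\<^sub>k x * \<bar>\<psi> x $ k\<bar> \<partial>?M)"
  have approx: "X \<le> B * Y + \<epsilon> * ((1 + B) * C)" if "\<epsilon> > 0" for \<epsilon>
  proof -
    obtain \<theta> where \<theta>: "\<theta> \<in> test_fields \<Omega>" and close: "graph_norm \<Omega> (\<lambda>x. \<phi> x - \<theta> x) < \<epsilon>"
      using assms(6) \<open>\<epsilon> > 0\<close> by (auto simp: R0_space_def)
    define \<zeta> \<rho> where "\<zeta> = (\<lambda>x. \<phi> x - \<theta> x)" and "\<rho> = weak_rot \<Omega> \<zeta>"
    have \<theta>_rot: "has_weak_rot \<Omega> \<theta> (classical_rot \<theta>)"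
      by (rule has_weak_rot_classical_rot[OF \<theta> \<Omega>])
    have \<theta>_L2: "\<theta> \<in> L2_fields \<Omega>"
      by (rule continuous_vanishing_L2[OF test_field_derivative(3)[OF \<theta>] test_field_support(1)[OF \<theta>] \<Omega>(2,1)])
    have rot_L2: "classical_rot \<theta> \<in> L2_fields \<Omega>" using \<theta>_rot by (simp add: has_weak_rot_def)
    have \<zeta>_L2: "\<zeta> \<in> L2_fields \<Omega>" unfolding \<zeta>_def by (rule L2_fields_diff[OF \<phi> \<theta>_L2])
    have \<zeta>_rot: "has_weak_rot \<Omega> \<zeta> (\<lambda>x. \<psi> x - classical_rot \<theta> x)"
      unfolding \<zeta>_def by (rule has_weak_rot_diff[OF \<Omega> \<phi> \<theta>_L2 \<psi> \<theta>_rot])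
    then have \<rho>: "has_weak_rot \<Omega> \<zeta> \<rho>" unfolding \<rho>_def weak_rot_def
      by (rule someI[where P = "has_weak_rot \<Omega> \<zeta>"])
    then have \<rho>_L2: "\<rho> \<in> L2_fields \<Omega>" by (simp add: has_weak_rot_def)
    have "L2_norm \<Omega> \<zeta> \<le> graph_norm \<Omega> \<zeta>" "L2_norm \<Omega> \<rho> \<le> graph_norm \<Omega> \<zeta>"
      by (auto simp: graph_norm_def \<rho>_def intro: real_le_rsqrt)
    with close have "L2_norm \<Omega> \<zeta> \<le> \<epsilon>" "L2_norm \<Omega> \<rho> \<le> \<epsilon>" by (auto simp: \<zeta>_def)
    then have \<zeta>_le: "(\<integral>x. norm (\<zeta> x) \<partial>?M) \<le> \<epsilon> * C" and \<rho>_le: "(\<integral>x. norm (\<rho> x) \<partial>?M) \<le> \<epsilon> * C"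
      unfolding C_def using integral_norm_le_of_L2_norm_le lm \<open>\<epsilon> > 0\<close> \<zeta>_L2 \<rho>_L2 by blast+
    note comp = L2_fields_component_integrable[OF _ lm]
    note norm_int = integrable_norm[OF L2_fields_integrable[OF _ lm]]

    \<comment> \<open>Replace \<open>\<phi>\<close> by \<open>\<theta>\<close> on the left.\<close>
    have "\<bar>(\<integral>x. indicator \<Omega>\<^sub>j\<^sub>k x * \<phi> x $ i \<partial>?M) - (\<integral>x. indicator \<Omega>\<^sub>j\<^sub>k x * \<theta> x $ i \<partial>?M)\<bar>
      = \<bar>\<integral>x. indicator \<Omega>\<^sub>j\<^sub>k x * \<zeta> x $ i \<partial>?M\<bar>"
      using int_ind[OF sub_M(2) comp[OF \<phi>]] int_ind[OF sub_M(2) comp[OF \<theta>_L2]]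
      by (simp add: \<zeta>_def right_diff_distrib)
    also have "\<dots> \<le> (\<integral>x. \<bar>indicator \<Omega>\<^sub>j\<^sub>k x * \<zeta> x $ i\<bar> \<partial>?M)" by (rule integral_abs_bound)
    also have "\<dots> \<le> (\<integral>x. norm (\<zeta> x) \<partial>?M)"
      using int_ind[OF sub_M(2) comp[OF \<zeta>_L2]] norm_int[OF \<zeta>_L2] component_le_norm_cart[of "\<zeta> _" i]
      by (intro integral_mono integrable_abs) (auto simp: indicator_def)
    finally have 1: "X \<le> \<bar>\<integral>x. indicator \<Omega>\<^sub>j\<^sub>k x * \<theta> x $ i \<partial>?M\<bar> + \<epsilon> * C"
      using \<zeta>_le unfolding X_def by linarith

    \<comment> \<open>The estimate for \<open>\<theta>\<close>, transferred from the whole space to \<open>\<Omega>\<close>, outside of which \<open>\<theta>\<close> and its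
      rotation vanish.\<close>
    have A_m: "A \<in> sets borel"
      unfolding A_def using strip[of "\<alpha>\<^sub>k" k "\<beta>\<^sub>k"] by auto
    have m: "(\<lambda>x. \<theta> x $ i) \<in> borel_measurable borel"
      "(\<lambda>x. \<bar>classical_rot \<theta> x $ k\<bar>) \<in> borel_measurable borel"
      "(\<lambda>x::real^3. x $ j) \<in> borel_measurable borel"
      by (intro borel_measurable_continuous_onI continuous_on_rabs continuous_on_component continuous_on_id
          test_field_derivative(3)[OF \<theta>] continuous_on_classical_rot[OF \<theta>])+
    have "(\<integral>x. indicator \<Omega>\<^sub>j\<^sub>k x * \<theta> x $ i \<partial>?M) =
        (\<integral>x. indicator A x * indicator {\<alpha>\<^sub>j<..<\<beta>\<^sub>j} (x $ j) * \<theta> x $ i \<partial>?M)"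
      by (intro Bochner_Integration.integral_cong) (simp_all add: ind_jk)
    also have "\<dots> = (\<integral>x. indicator A x * indicator {\<alpha>\<^sub>j<..<\<beta>\<^sub>j} (x $ j) * \<theta> x $ i \<partial>lborel)"
    proof (rule integral_lebesgue_on_vanishing[OF _ _ \<Omega>(1)])
      show "(\<lambda>x. indicator A x * indicator {\<alpha>\<^sub>j<..<\<beta>\<^sub>j} (x $ j) * \<theta> x $ i) \<in> borel_measurable borel"
        by (intro borel_measurable_times m borel_measurable_indicator A_m
            measurable_compose[OF m(3) borel_measurable_indicator]) auto
    qed (simp add: test_field_support(1)[OF \<theta>])
    also have "\<bar>\<dots>\<bar> \<le> B * (\<integral>x. indicator A x * \<bar>classical_rot \<theta> x $ k\<bar> \<partial>lborel)"
      unfolding A_def B_def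
      by (rule test_field_box_integral_le[OF \<theta> \<Omega> assms(7)]) (use assms in auto)
    also have "(\<integral>x. indicator A x * \<bar>classical_rot \<theta> x $ k\<bar> \<partial>lborel) =
        (\<integral>x. indicator A x * \<bar>classical_rot \<theta> x $ k\<bar> \<partial>?M)"
      by (rule integral_lebesgue_on_vanishing[OF _ _ \<Omega>(1), symmetric])
         (intro borel_measurable_times m borel_measurable_indicator A_m,
          simp add: classical_rot_eq_0[OF \<theta>])
    also have "\<dots> = (\<integral>x. indicator \<Omega>\<^sub>k x * \<bar>classical_rot \<theta> x $ k\<bar> \<partial>?M)"
      by (intro Bochner_Integration.integral_cong) (simp_all add: ind_A)
    finally have 2: "\<bar>\<integral>x. indicator \<Omega>\<^sub>j\<^sub>k x * \<theta> x $ i \<partial>?M\<bar> \<le> B * (\<integral>x. indicator \<Omega>\<^sub>k x * \<bar>classical_rot \<theta> x $ k\<bar> \<partial>?M)" .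

    \<comment> \<open>Replace the rotation of \<open>\<theta>\<close> by \<open>\<psi>\<close> on the right; the error is the chosen representative \<open>\<rho>\<close> of the
      weak rotation of \<open>\<phi> - \<theta>\<close>, by uniqueness almost everywhere.\<close>
    have "(\<integral>x. indicator \<Omega>\<^sub>k x * \<bar>classical_rot \<theta> x $ k\<bar> \<partial>?M) \<le>
        (\<integral>x. indicator \<Omega>\<^sub>k x * \<bar>\<psi> x $ k\<bar> + norm (\<rho> x) \<partial>?M)"
    proof (rule integral_mono_AE)
      show "integrable ?M (\<lambda>x. indicator \<Omega>\<^sub>k x * \<bar>classical_rot \<theta> x $ k\<bar>)"
        by (intro int_ind sub_M integrable_abs comp rot_L2)
      show "integrable ?M (\<lambda>x. indicator \<Omega>\<^sub>k x * \<bar>\<psi> x $ k\<bar> + norm (\<rho> x))"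
        by (intro Bochner_Integration.integrable_add int_ind sub_M integrable_abs comp \<psi>_L2 norm_int \<rho>_L2)
      from weak_rot_unique[OF \<Omega> \<rho> \<zeta>_rot]
      show "AE x in ?M. indicator \<Omega>\<^sub>k x * \<bar>classical_rot \<theta> x $ k\<bar> \<le> indicator \<Omega>\<^sub>k x * \<bar>\<psi> x $ k\<bar> + norm (\<rho> x)"
      proof eventually_elim
        case (elim x)
        have "\<bar>\<rho> x $ k\<bar> \<le> norm (\<rho> x)" by (rule component_le_norm_cart)
        moreover have "\<rho> x $ k = \<psi> x $ k - classical_rot \<theta> x $ k" using elim by simp
        ultimately show ?case by (auto simp: indicator_def)
      qed
    qed
    also have "\<dots> = Y + (\<integral>x. norm (\<rho> x) \<partial>?M)"
      unfolding Y_def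
      by (intro Bochner_Integration.integral_add int_ind sub_M integrable_abs comp \<psi>_L2 norm_int \<rho>_L2)
    finally have "(\<integral>x. indicator \<Omega>\<^sub>k x * \<bar>classical_rot \<theta> x $ k\<bar> \<partial>?M) \<le> Y + \<epsilon> * C"
      using \<rho>_le by linarith
    from mult_left_mono[OF this, of B] 1 2 \<open>B > 0\<close> show ?thesis
      by (simp add: algebra_simps)
  qed
  have "X \<le> B * Y"
  proof (rule field_le_epsilon)
    fix e :: real assume "0 < e"
    define D where "D = (1 + B) * C"
    have "D > 0" using \<open>B > 0\<close> \<open>C > 0\<close> by (simp add: D_def)
    with approx[of "e / D", folded D_def] \<open>0 < e\<close> show "X \<le> B * Y + e" by simp
  qed
  moreover have "\<bar>\<integral>x. \<phi> x $ i \<partial>lebesgue_on \<Omega>\<^sub>j\<^sub>k\<bar> = X"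
    unfolding X_def by (simp only: integral_lebesgue_on_subset[OF sub_m(2) \<Omega>_m sub(2)])
  moreover have "L1_norm \<Omega>\<^sub>k (\<lambda>x. weak_rot \<Omega> \<phi> x $ k) = Y"
    unfolding L1_norm_def Y_def \<psi>_def by (rule integral_lebesgue_on_subset[OF sub_m(1) \<Omega>_m sub(1)])
  ultimately show ?thesis by (simp add: \<Omega>\<^sub>j\<^sub>k_def \<Omega>\<^sub>k_def B_def)
qed

end
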